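(* Let $m\in\mathbb N$, let $\Omega^h\subset\Omega$ be a nonempty finite set, and let $H\subseteq\mathcal H$ be a class of depth-$L$ neural networks satisfying one of the following: (i) $H=\mathcal H_{\mathrm{sm},m}(\Omega^h)$ consists of ReLU neural networks (activation $\sigma(x)=\max\{0,x\}$) of depth $L\ge\lceil\log_2(d+1)\rceil+1$. (ii) $H=\mathcal H_{\mathrm{sm},\ell}(\Omega^h)$, where $\ell:=|\Omega^h|(m+1)$, consists of neural networks with activation function $\sigma\in C^{\ell}(\mathbb R)$ such that there exists $s\in\mathbb R$ with $D^k\sigma(s)\neq0$ for all $0\le k\le\ell$, and depth $L\ge2$. If $L>2$, it is additionally assumed that $\sigma$ is strictly monotone. Then $\operatorname{argmin}_{u_\theta\in H}\mathcal J_{\mathrm{reg}}^h(u_\theta)$ always has a solution $u_\theta\in H$ with $\mathcal J_{\mathrm{reg}}^h(u_\theta)=0$. In particular, there exist infinitely many such solutions.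
   Context: Let $d\in\mathbb N$ and let $\Omega\subset\mathbb R^d$ be a bounded open domain with Lipschitz boundary. $|A|$ denotes the cardinality of a finite set $A$. Neural networks. For a fixed activation $\sigma:\mathbb R\to\mathbb R$ and depth $L\in\mathbb N$, $\mathcal N_L$ is the set of all functions $f:\mathbb R^d\to\mathbb R$ of the form $\varphi_0(x)=x$, $\varphi_i(x)=\sigma(W_i\varphi_{i-1}(x)+b_i)$ for $i=1,\dots,L-1$ ($\sigma$ applied componentwise), $f(x)=W_L\varphi_{L-1}(x)+b_L$, with $W_i\in\mathbb R^{d_i\times d_{i-1}}$, $b_i\in\mathbb R^{d_i}$, $d_0=d$, $d_L=1$, and arbitrary hidden widths $d_1,\dots,d_{L-1}\in\mathbb N$. Set $\mathcal H:=\{f|_\Omega: f\in\mathcal N_L\}$. For $r\in\mathbb N_0$, $\mathcal H_{\mathrm{sm},r}(\Omega^h)$ is the set of elements of $\mathcal H$ that are $C^r$ at every $x\in\Omega^h$ (that is, $r$ times continuously differentiable in a neighbourhood of each $x\in\Omega^h$). Elements are regarded as functions, so "infinitely many" refers to distinct functions on $\Omega$. Discrete regularization loss. Let $\eta:=\sum_{k=1}^m\binom{d+k-1}{k}$ be the number of multi-indices $\beta\in\mathbb N_0^d$ with $1\le|\beta|\le m$, and let $R:\mathbb R^\eta\to[0,\infty]$ be a Borel-measurable function with $R(0)=0$. Let $\alpha_1,\alpha_2\ge0$, let $g^h:\Omega^h\to\mathbb R$ be given data (the restriction or sampling to $\Omega^h$ of a function $g\in L^2(\Omega)$), and let $\omega_{\mathcal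 D}^x,\omega_{\mathcal R}^x\ge0$ ($x\in\Omega^h$) be quadrature weights. Then $$\mathcal J_{\mathrm{reg}}^h(u):=\sum_{\tau=1}^2\alpha_\tau\sum_{x\in\Omega^h}\omega_{\mathcal D}^x\,|u(x)-g^h(x)|^\tau+\sum_{x\in\Omega^h}\omega_{\mathcal R}^x\,R\big((D^\beta u(x))_{1\le|\beta|\le m}\big),$$ where the derivatives $D^\beta u(x)$ are evaluated pointwise (classically) at $x\in\Omega^h$. *)

theory Defs
  imports "HOL-Analysis.Analysis" "HOL-Library.FuncSet"
begin

section \<open>Lipschitz domains\<close>

text \<open>
  Near every boundary point, after a rotation taking the unit vector \<open>\<nu>\<close> to the last coordinate
  axis, the set is the strict epigraph of a Lipschitz function \<open>\<gamma>\<close> on the hyperplane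
  orthogonal to \<open>\<nu>\<close>; the term \<open>x - (x \<bullet> \<nu>) *\<^sub>R \<nu>\<close> is the projection of \<open>x\<close> to that hyperplane.
\<close>

definition lipschitz_boundary :: "(real ^ 'n) set \<Rightarrow> bool" where
  "lipschitz_boundary \<Omega> \<longleftrightarrow>
     (\<forall>p \<in> frontier \<Omega>. \<exists>r > 0. \<exists>\<nu>. \<exists>K. \<exists>\<gamma> :: real ^ 'n \<Rightarrow> real.
        norm \<nu> = 1 \<and> K-lipschitz_on {y. y \<bullet> \<nu> = 0} \<gamma> \<and>
        \<Omega> \<inter> ball p r = {x \<in> ball p r. \<gamma> (x - (x \<bullet> \<nu>) *\<^sub>R \<nu>) < x \<bullet> \<nu>})"

definition bounded_lipschitz_domain :: "(real ^ 'n) set \<Rightarrow> bool" where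
  "bounded_lipschitz_domain \<Omega> \<longleftrightarrow>
     \<Omega> \<noteq> {} \<and> open \<Omega> \<and> connected \<Omega> \<and> bounded \<Omega> \<and> lipschitz_boundary \<Omega>"


section \<open>Neural networks\<close>

definition relu :: "real \<Rightarrow> real" where
  "relu t = max 0 t"

text \<open>
  As widths vary, vectors and matrices are functions on natural numbers, read with zero-based
  indices: layer \<open>i\<close> has width \<open>w i\<close>, the matrix \<open>W i\<close> has entries \<open>W i j k\<close> with
  \<open>j < w i\<close> and \<open>k < w (i - 1)\<close>, and \<open>b i\<close> has entries \<open>b i j\<close> with \<open>j < w i\<close>.
  Entries outside these ranges have no influence on the network function. The coordinates
  of \<open>x :: real ^ 'n\<close> are numbered by the bijection \<open>from_nat_into UNIV\<close> from \<open>{..<CARD('n)}\<close>.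
\<close>

definition affine_layer ::
    "(nat \<Rightarrow> nat) \<Rightarrow> (nat \<Rightarrow> nat \<Rightarrow> nat \<Rightarrow> real) \<Rightarrow> (nat \<Rightarrow> nat \<Rightarrow> real) \<Rightarrow>
     nat \<Rightarrow> (nat \<Rightarrow> real) \<Rightarrow> nat \<Rightarrow> real" where
  "affine_layer w W b i v j = (\<Sum>k<w (i - 1). W i j k * v k) + b i j"

primrec hidden_layer ::
    "(real \<Rightarrow> real) \<Rightarrow> (nat \<Rightarrow> nat) \<Rightarrow> (nat \<Rightarrow> nat \<Rightarrow> nat \<Rightarrow> real) \<Rightarrow> (nat \<Rightarrow> nat \<Rightarrow> real) \<Rightarrow>
     nat \<Rightarrow> real ^ 'n \<Rightarrow> nat \<Rightarrow> real" where
  "hidden_layer \<sigma> w W b 0 x = (\<lambda>j. x $ from_nat_into UNIV j)"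
| "hidden_layer \<sigma> w W b (Suc i) x =
     (\<lambda>j. \<sigma> (affine_layer w W b (Suc i) (hidden_layer \<sigma> w W b i x) j))"

definition neural_networks :: "(real \<Rightarrow> real) \<Rightarrow> nat \<Rightarrow> (real ^ 'n \<Rightarrow> real) set" where
  "neural_networks \<sigma> L =
     {f. \<exists>w W b. w 0 = CARD('n) \<and> w L = 1 \<and> (\<forall>i. 1 \<le> i \<and> i < L \<longrightarrow> w i \<ge> 1) \<and>
         f = (\<lambda>x. affine_layer w W b L (hidden_layer \<sigma> w W b (L - 1) x) 0)}"

text \<open>
  \<open>restrict f \<Omega>\<close> takes a fixed value off \<open>\<Omega>\<close>, so equality of elements is equality of
  functions on \<open>\<Omega>\<close>.
\<close>

definition network_class :: "(real \<Rightarrow> real) \<Rightarrow> nat \<Rightarrow> (real ^ 'n) set \<Rightarrow> (real ^ 'n \<Rightarrow> real) set" where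
  "network_class \<sigma> L \<Omega> = (\<lambda>f. restrict f \<Omega>) ` neural_networks \<sigma> L"


section \<open>Classical derivatives and smoothness\<close>

definition partial_deriv :: "'n \<Rightarrow> (real ^ 'n \<Rightarrow> real) \<Rightarrow> real ^ 'n \<Rightarrow> real" where
  "partial_deriv i u x = deriv (\<lambda>t. u (x + t *\<^sub>R axis i 1)) 0"

text \<open>
  A multi-index is a function \<open>\<beta> :: 'n \<Rightarrow> nat\<close>. The derivative \<open>D\<^sup>\<beta>\<close> is
  \<open>\<partial>\<^sub>1\<^sup>\<beta>\<^sup>1 \<dots> \<partial>\<^sub>d\<^sup>\<beta>\<^sup>d\<close>, the coordinates being numbered by \<open>from_nat_into UNIV\<close>; the numbering
  is immaterial for functions with continuous derivatives of order \<open>|\<beta>|\<close>.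
\<close>

definition multi_deriv :: "('n :: finite \<Rightarrow> nat) \<Rightarrow> (real ^ 'n \<Rightarrow> real) \<Rightarrow> real ^ 'n \<Rightarrow> real" where
  "multi_deriv \<beta> u =
     foldr (\<lambda>i v. (partial_deriv i ^^ \<beta> i) v) (map (from_nat_into UNIV) [0..<CARD('n)]) u"

definition multi_indices :: "nat \<Rightarrow> ('n :: finite \<Rightarrow> nat) set" where
  "multi_indices m = {\<beta>. 1 \<le> sum \<beta> UNIV \<and> sum \<beta> UNIV \<le> m}"

primrec Ck_on :: "nat \<Rightarrow> (real ^ 'n \<Rightarrow> real) \<Rightarrow> (real ^ 'n) set \<Rightarrow> bool" where
  "Ck_on 0 u U \<longleftrightarrow> continuous_on U u"
| "Ck_on (Suc r) u U \<longleftrightarrow> u differentiable_on U \<and> (\<forall>i. Ck_on r (partial_deriv i u) U)"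

definition Ck_at :: "nat \<Rightarrow> (real ^ 'n \<Rightarrow> real) \<Rightarrow> real ^ 'n \<Rightarrow> bool" where
  "Ck_at r u x \<longleftrightarrow> (\<exists>U. open U \<and> x \<in> U \<and> Ck_on r u U)"

definition Ck_real :: "nat \<Rightarrow> (real \<Rightarrow> real) \<Rightarrow> bool" where
  "Ck_real r \<sigma> \<longleftrightarrow>
     (\<forall>j<r. \<forall>t. ((deriv ^^ j) \<sigma>) field_differentiable (at t)) \<and> continuous_on UNIV ((deriv ^^ r) \<sigma>)"

definition smooth_network_class ::
    "(real \<Rightarrow> real) \<Rightarrow> nat \<Rightarrow> (real ^ 'n) set \<Rightarrow> nat \<Rightarrow> (real ^ 'n) set \<Rightarrow> (real ^ 'n \<Rightarrow> real) set" where
  "smooth_network_class \<sigma> L \<Omega> r \<Omega>h = {u \<in> network_class \<sigma> L \<Omega>. \<forall>x\<in>\<Omega>h. Ck_at r u x}"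


section \<open>The discrete regularization loss\<close>

text \<open>
  \<open>\<real>\<^sup>\<eta>\<close> is the set of real families indexed by \<open>multi_indices m\<close>, with \<open>\<eta> = card (multi_indices m)\<close>
  (see \<open>card_multi_indices\<close>). Its Borel sets are those of the product measure space below,
  and its elements are functions restricted to the index set.
\<close>

definition deriv_space :: "nat \<Rightarrow> (('n :: finite \<Rightarrow> nat) \<Rightarrow> real) measure" where
  "deriv_space m = (\<Pi>\<^sub>M \<beta> \<in> multi_indices m. borel)"

text \<open>Products follow the convention \<open>0 * \<infinity> = 0\<close> of \<open>ennreal\<close>.\<close>

definition J_reg ::
    "nat \<Rightarrow> (real ^ 'n) set \<Rightarrow> (nat \<Rightarrow> real) \<Rightarrow> (real ^ 'n \<Rightarrow> real) \<Rightarrow> (real ^ 'n \<Rightarrow> real) \<Rightarrow>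
     (real ^ 'n \<Rightarrow> real) \<Rightarrow> ((('n :: finite \<Rightarrow> nat) \<Rightarrow> real) \<Rightarrow> ennreal) \<Rightarrow>
     (real ^ 'n \<Rightarrow> real) \<Rightarrow> ennreal" where
  "J_reg m \<Omega>h \<alpha> gh \<omega>D \<omega>R R u =
     ennreal (\<Sum>\<tau>=1..2. \<alpha> \<tau> * (\<Sum>x\<in>\<Omega>h. \<omega>D x * \<bar>u x - gh x\<bar> ^ \<tau>)) +
     (\<Sum>x\<in>\<Omega>h. ennreal (\<omega>R x) * R (\<lambda>\<beta> \<in> multi_indices m. multi_deriv \<beta> u x))"


section \<open>The number of multi-indices\<close>

lemma card_multi_indices_eq:
  "finite {\<beta> :: 'n :: finite \<Rightarrow> nat. sum \<beta> UNIV = k}"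
  "card {\<beta> :: 'n :: finite \<Rightarrow> nat. sum \<beta> UNIV = k} = (CARD('n) + k - 1) choose k"
proof -
  obtain xs :: "'n list" where xs: "set xs = UNIV" "distinct xs"
    using finite_distinct_list[OF finite] by blast
  have len: "length xs = CARD('n)"
    using distinct_card[OF xs(2)] xs(1) by simp
  let ?A = "{\<beta> :: 'n \<Rightarrow> nat. sum \<beta> UNIV = k}"
  let ?B = "{l :: nat list. length l = CARD('n) \<and> sum_list l = k}"
  have sl: "sum_list (map \<beta> xs) = sum \<beta> UNIV" for \<beta> :: "'n \<Rightarrow> nat"
    using sum_list_distinct_conv_sum_set[OF xs(2)] xs(1) by simp
  have bij: "bij_betw (\<lambda>\<beta>. map \<beta> xs) ?A ?B"
    unfolding bij_betw_def
  proof
    show "inj_on (\<lambda>\<beta>. map \<beta> xs) ?A"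
      using xs(1) by (auto simp: inj_on_def fun_eq_iff)
    show "(\<lambda>\<beta>. map \<beta> xs) ` ?A = ?B"
    proof
      show "(\<lambda>\<beta>. map \<beta> xs) ` ?A \<subseteq> ?B"
        using len sl by auto
      show "?B \<subseteq> (\<lambda>\<beta>. map \<beta> xs) ` ?A"
      proof
        fix l assume l: "l \<in> ?B"
        define \<beta> where "\<beta> = (\<lambda>i. the (map_of (zip xs l) i))"
        have "map \<beta> xs = l"
          using l len xs(2) by (auto simp: \<beta>_def list_eq_iff_nth_eq map_of_zip_nth)
        then show "l \<in> (\<lambda>\<beta>. map \<beta> xs) ` ?A"
          using l sl[of \<beta>] by auto
      qed
    qed
  qed
  have "?B \<subseteq> {l. set l \<subseteq> {..k} \<and> length l = CARD('n)}"
    using member_le_sum_list by fastforce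
  then have "finite ?B"
    by (rule finite_subset) (simp add: finite_lists_length_eq)
  then show "finite ?A"
    using bij_betw_finite[OF bij] by simp
  show "card ?A = (CARD('n) + k - 1) choose k"
    using bij_betw_same_card[OF bij] card_length_sum_list[of "CARD('n)" k]
    by (simp add: add.commute)
qed

lemma card_multi_indices:
  "card (multi_indices m :: ('n :: finite \<Rightarrow> nat) set) = (\<Sum>k=1..m. (CARD('n) + k - 1) choose k)"
proof -
  have "(multi_indices m :: ('n \<Rightarrow> nat) set) = (\<Union>k\<in>{1..m}. {\<beta>. sum \<beta> UNIV = k})"
    by (auto simp: multi_indices_def)
  then have "card (multi_indices m :: ('n \<Rightarrow> nat) set) =
      (\<Sum>k=1..m. card {\<beta> :: 'n \<Rightarrow> nat. sum \<beta> UNIV = k})"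
    by (simp only:) (rule card_UN_disjoint, auto simp: card_multi_indices_eq(1))
  then show ?thesis
    by (simp add: card_multi_indices_eq(2))
qed

end

theory Submission
  imports Defs "HOL-Computational_Algebra.Polynomial"
begin

text \<open>
  The loss vanishes at every \<open>u\<close> that takes the given values on \<open>\<Omega>h\<close> and whose derivatives of
  orders \<open>1, \<dots>, m\<close> are zero there, because \<open>R\<close> is zero at the origin; as the loss is nonnegative,
  such a \<open>u\<close> is a minimiser. To obtain infinitely many of them, the value at one further point
  \<open>x0 \<in> \<Omega> - \<Omega>h\<close> is prescribed too: different values belong to different functions
  (\<open>infinitely_many_minimisers\<close>).

  The functions \<open>u\<close> are found among ridge functions \<open>x \<mapsto> p (\<psi> (v \<bullet> x + \<beta>))\<close>. The direction \<open>v\<close>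
  separates the finitely many points (\<open>exists_injective_direction\<close>); \<open>\<psi> = \<sigma> ^^ (L - 2)\<close> comes from
  intermediate layers of width one, and it keeps the points separated; \<open>p\<close> is a function of one
  real variable that a single hidden layer realises (\<open>ridge_network\<close>). Derivatives of a ridge
  function are multiples of derivatives in one variable (\<open>multi_deriv_ridge\<close>), and \<open>p \<circ> \<psi>\<close> is flat
  wherever \<open>p\<close> is flat at the image point (\<open>higher_deriv_comp_zero\<close>). What remains is to find \<open>p\<close>
  with prescribed values and vanishing derivatives at finitely many distinct reals.

  For ReLU, sums of plateau functions do this: they are locally constant at the nodes
  (\<open>relu_locally_constant_interpolation\<close>). For a smooth activation there are \<open>l + 1\<close> linear
  conditions on \<open>p\<close>. By duality (\<open>interpolation_of_no_annihilator\<close>) they can be met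
  unless a nontrivial combination \<open>\<Lambda>\<close> of the functionals \<open>p \<mapsto> p\<^sup>(\<^sup>k\<^sup>) z\<close> annihilates all
  dilates \<open>t \<mapsto> \<sigma> (w * t + s)\<close>. Taylor expansion in \<open>w\<close> at \<open>0\<close> shows that such a \<open>\<Lambda>\<close> annihilates
  the monomials \<open>1, t, \<dots>, t\<^sup>l\<close>, as \<open>\<sigma>\<close> has nonzero derivatives at \<open>s\<close> up to order \<open>l\<close>
  (\<open>Hermite_functionals_independent_on_dilates\<close>); but polynomial Hermite interpolation with
  \<open>l + 1\<close> conditions is uniquely solvable in degree at most \<open>l\<close>, so \<open>\<Lambda> = 0\<close>.
\<close>

section \<open>Functions of class \<open>C\<^sup>r\<close> on the real line\<close>

lemma Ck_real_0: "Ck_real 0 f \<longleftrightarrow> continuous_on UNIV f"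
  by (simp add: Ck_real_def)

lemma Ck_real_Suc:
  "Ck_real (Suc r) f \<longleftrightarrow> (\<forall>t. f field_differentiable (at t)) \<and> Ck_real r (deriv f)"
  unfolding Ck_real_def by (auto simp: All_less_Suc2 funpow_Suc_right simp del: funpow.simps)

lemma Ck_real_pred: "Ck_real (Suc r) f \<Longrightarrow> Ck_real r f"
proof (induction r arbitrary: f)
  case 0
  then show ?case
    by (auto simp: Ck_real_Suc Ck_real_0 continuous_on_eq_continuous_at
        field_differentiable_imp_continuous_at)
next
  case (Suc r)
  then show ?case by (metis Ck_real_Suc)
qed

lemma Ck_real_Suc_deriv: "Ck_real (Suc r) f \<Longrightarrow> Ck_real r (deriv f)"
  by (simp add: Ck_real_Suc)


lemma Ck_real_higher_deriv: "Ck_real (k + r) f \<Longrightarrow> Ck_real r ((deriv ^^ k) f)"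
  by (induction k arbitrary: f)
    (simp_all add: funpow_Suc_right Ck_real_Suc_deriv del: funpow.simps(2))

lemma Ck_real_mono: "Ck_real r f \<Longrightarrow> q \<le> r \<Longrightarrow> Ck_real q f"
  by (induction r) (auto simp: le_Suc_eq dest: Ck_real_pred)

lemma Ck_real_deriv: "Ck_real (Suc r) f \<Longrightarrow> (f has_real_derivative deriv f t) (at t)"
  using Ck_real_Suc DERIV_deriv_iff_field_differentiable by blast

lemma Ck_real_SucI:
  assumes "\<And>t. (f has_real_derivative f' t) (at t)" "Ck_real r f'"
  shows "Ck_real (Suc r) f" "deriv f = f'"
proof -
  show *: "deriv f = f'" using assms(1) DERIV_imp_deriv by blast
  show "Ck_real (Suc r) f"
    using assms * by (auto simp: Ck_real_Suc field_differentiable_def)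
qed

lemma Ck_real_lincomb:
  assumes "Ck_real r f" "Ck_real r g"
  shows "Ck_real r (\<lambda>t. a * f t + b * g t)"
  using assms
proof (induction r arbitrary: f g)
  case 0
  then show ?case by (auto simp: Ck_real_0 intro!: continuous_intros)
next
  case (Suc r)
  show ?case
    by (rule Ck_real_SucI(1)[where f' = "\<lambda>t. a * deriv f t + b * deriv g t"])
      (use Suc in \<open>auto intro!: derivative_eq_intros Ck_real_deriv simp: Ck_real_Suc\<close>)
qed

lemma higher_deriv_lincomb:
  assumes "Ck_real r f" "Ck_real r g" "k \<le> r"
  shows "(deriv ^^ k) (\<lambda>t. a * f t + b * g t) = (\<lambda>t. a * (deriv ^^ k) f t + b * (deriv ^^ k) g t)"
  using assms
proof (induction k arbitrary: f g r)
  case (Suc k)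
  then obtain q where r: "r = Suc q" by (cases r) auto
  have "deriv (\<lambda>t. a * f t + b * g t) = (\<lambda>t. a * deriv f t + b * deriv g t)"
    by (rule Ck_real_SucI(2)[where r = q])
      (use Suc r in \<open>auto intro!: derivative_eq_intros Ck_real_deriv Ck_real_lincomb simp: Ck_real_Suc\<close>)
  then show ?case
    using Suc.IH[of q "deriv f" "deriv g"] Suc.prems r
    by (simp add: funpow_Suc_right Ck_real_Suc del: funpow.simps)
qed simp

lemma Ck_real_mult:
  assumes "Ck_real r f" "Ck_real r g"
  shows "Ck_real r (\<lambda>t. f t * g t)"
  using assms
proof (induction r arbitrary: f g)
  case 0
  then show ?case by (auto simp: Ck_real_0 intro!: continuous_intros)
next
  case (Suc r)
  have "Ck_real r (\<lambda>t. 1 * (deriv f t * g t) + 1 * (f t * deriv g t))"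
    using Suc.prems by (intro Ck_real_lincomb Suc.IH) (simp_all add: Ck_real_Suc_deriv Ck_real_pred)
  then show ?case
    by (intro Ck_real_SucI(1)[where f' = "\<lambda>t. deriv f t * g t + f t * deriv g t"])
      (use Suc.prems in \<open>auto intro!: derivative_eq_intros Ck_real_deriv\<close>)
qed

lemma Ck_real_compose:
  assumes "Ck_real r f" "Ck_real r g"
  shows "Ck_real r (\<lambda>t. f (g t))"
  using assms
proof (induction r arbitrary: f)
  case 0
  then show ?case
    by (auto simp: Ck_real_0 intro: continuous_on_compose2)
next
  case (Suc r)
  show ?case
  proof (rule Ck_real_SucI(1)[where f' = "\<lambda>t. deriv f (g t) * deriv g t"])
    show "((\<lambda>t. f (g t)) has_real_derivative deriv f (g t) * deriv g t) (at t)" for t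
      using DERIV_chain2[OF Ck_real_deriv Ck_real_deriv] Suc.prems(1,2) by blast
    show "Ck_real r (\<lambda>t. deriv f (g t) * deriv g t)"
      by (intro Ck_real_mult Ck_real_Suc_deriv[OF Suc.prems(2)]
          Suc.IH[OF Ck_real_Suc_deriv[OF Suc.prems(1)] Ck_real_pred[OF Suc.prems(2)]])
  qed
qed

lemma Ck_real_poly: "Ck_real r (poly p)"
proof (induction r arbitrary: p)
  case (Suc r)
  show ?case by (rule Ck_real_SucI(1)[OF poly_DERIV Suc.IH])
qed (simp add: Ck_real_0 continuous_on_eq_continuous_at)

lemma higher_deriv_poly:
  fixes p :: "real poly"
  shows "(deriv ^^ k) (poly p) = poly ((pderiv ^^ k) p)"
proof (induction k)
  case (Suc k)
  then show ?case using Ck_real_SucI(2)[OF poly_DERIV Ck_real_poly] by simp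
qed simp

lemma Ck_real_const: "Ck_real r (\<lambda>t. c)"
proof -
  have "poly [:c:] = (\<lambda>t. c)" by auto
  then show ?thesis by (metis Ck_real_poly)
qed

lemma Ck_real_affine: "Ck_real r (\<lambda>t. a * t + b)"
proof -
  have "poly [:b, a:] = (\<lambda>t. a * t + b)" by (auto simp: algebra_simps)
  then show ?thesis by (metis Ck_real_poly)
qed

lemma Ck_real_funpow: "Ck_real r f \<Longrightarrow> Ck_real r (f ^^ n)"
proof (induction n)
  case 0
  then show ?case using Ck_real_affine[of r 1 0] by (simp add: id_def)
next
  case (Suc n)
  then show ?case by (simp add: comp_def Ck_real_compose)
qed

lemma higher_deriv_affine:
  assumes "Ck_real r f" "k \<le> r"
  shows "(deriv ^^ k) (\<lambda>t. f (a * t + b)) = (\<lambda>t. a ^ k * (deriv ^^ k) f (a * t + b))"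
  using assms
proof (induction k arbitrary: f r)
  case (Suc k)
  then obtain q where r: "r = Suc q" by (cases r) auto
  have f': "Ck_real q (\<lambda>t. deriv f (a * t + b))"
    using Ck_real_compose[OF Ck_real_Suc_deriv Ck_real_affine] Suc.prems r by blast
  have "deriv (\<lambda>t. f (a * t + b)) = (\<lambda>t. a * deriv f (a * t + b) + 0 * deriv f (a * t + b))"
  proof (rule Ck_real_SucI(2)[where r = q])
    show "((\<lambda>t. f (a * t + b)) has_real_derivative
        a * deriv f (a * t + b) + 0 * deriv f (a * t + b)) (at t)" for t
      by (rule DERIV_cong[OF DERIV_chain2[where g = "\<lambda>t. a * t + b", OF Ck_real_deriv]])
        (use Suc.prems r in \<open>auto intro!: derivative_eq_intros\<close>)
  qed (intro Ck_real_lincomb f')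
  then show ?case
    using Suc.IH[of q "deriv f"] Suc.prems r higher_deriv_lincomb[OF f' f', of k a 0]
    by (simp add: funpow_Suc_right Ck_real_Suc mult.assoc del: funpow.simps)
qed simp

text \<open>
  By the chain and product rules, every derivative of \<open>q \<circ> \<psi>\<close> is a combination of terms
  \<open>q\<^sup>(\<^sup>j\<^sup>) \<circ> \<psi>\<close> with coefficients built from \<open>\<psi>\<close>. The extra factor \<open>g\<close> collects these
  coefficients, so that the induction works without naming them.
\<close>
lemma higher_deriv_mult_comp_zero:
  assumes "Ck_real k q" "Ck_real k \<psi>" "Ck_real k g" and "\<And>j. j \<le> k \<Longrightarrow> (deriv ^^ j) q (\<psi> t) = 0"
  shows "(deriv ^^ k) (\<lambda>t. q (\<psi> t) * g t) t = 0"
  using assms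
proof (induction k arbitrary: q g)
  case (Suc k)
  define A where "A = (\<lambda>t. deriv q (\<psi> t) * (deriv \<psi> t * g t))"
  define B where "B = (\<lambda>t. q (\<psi> t) * deriv g t)"
  have C: "Ck_real k (deriv q)" "Ck_real k (deriv \<psi>)" "Ck_real k (deriv g)"
      "Ck_real k q" "Ck_real k \<psi>" "Ck_real k g"
    using Suc.prems(1-3)[THEN Ck_real_Suc_deriv] Suc.prems(1-3)[THEN Ck_real_pred] by auto
  have AB: "Ck_real k A" "Ck_real k B"
    unfolding A_def B_def using Ck_real_mult[OF Ck_real_compose[OF C(1) C(5)] Ck_real_mult[OF C(2,6)]]
      Ck_real_mult[OF Ck_real_compose[OF C(4,5)] C(3)] by auto
  have "deriv (\<lambda>t. q (\<psi> t) * g t) = (\<lambda>t. 1 * A t + 1 * B t)"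
  proof (rule Ck_real_SucI(2)[where r = k])
    fix t
    have "((\<lambda>t. q (\<psi> t)) has_real_derivative deriv q (\<psi> t) * deriv \<psi> t) (at t)"
      using DERIV_chain2[OF Ck_real_deriv Ck_real_deriv] Suc.prems(1,2) by blast
    then show "((\<lambda>t. q (\<psi> t) * g t) has_real_derivative 1 * A t + 1 * B t) (at t)"
      unfolding A_def B_def
      by (rule DERIV_cong[OF DERIV_mult[OF _ Ck_real_deriv[OF Suc.prems(3)]]]) simp
  qed (intro Ck_real_lincomb AB)
  then have "(deriv ^^ Suc k) (\<lambda>t. q (\<psi> t) * g t) t = (deriv ^^ k) A t + (deriv ^^ k) B t"
    using higher_deriv_lincomb[OF AB, of k 1 1] by (simp add: funpow_Suc_right del: funpow.simps)
  also have "(deriv ^^ k) A t = 0"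
    unfolding A_def
  proof (rule Suc.IH[OF C(1,5) Ck_real_mult[OF C(2,6)]])
    show "(deriv ^^ j) (deriv q) (\<psi> t) = 0" if "j \<le> k" for j
      using Suc.prems(4)[of "Suc j"] that by (simp add: funpow_Suc_right del: funpow.simps)
  qed
  also have "(deriv ^^ k) B t = 0"
    unfolding B_def by (rule Suc.IH[OF C(4,5,3) Suc.prems(4)]) simp
  finally show ?case by simp
qed simp

text \<open>
  Flatness of \<open>p\<close> at \<open>\<psi> t\<close> is inherited by \<open>p \<circ> \<psi>\<close> at \<open>t\<close>, whatever the derivatives of \<open>\<psi>\<close> are.
  Hence flatness can be arranged in the last hidden layer of a deep network alone.
\<close>
lemma higher_deriv_comp_zero:
  assumes "Ck_real k p" "Ck_real k \<psi>" "k \<ge> 1"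
    and "\<And>j. 1 \<le> j \<Longrightarrow> j \<le> k \<Longrightarrow> (deriv ^^ j) p (\<psi> t) = 0"
  shows "(deriv ^^ k) (\<lambda>t. p (\<psi> t)) t = 0"
proof -
  obtain q where k: "k = Suc q" using assms(3) by (cases k) auto
  have "deriv (\<lambda>t. p (\<psi> t)) = (\<lambda>t. deriv p (\<psi> t) * deriv \<psi> t)"
    using DERIV_imp_deriv[OF DERIV_chain2[OF Ck_real_deriv Ck_real_deriv]] assms(1,2) k by blast
  moreover have "(deriv ^^ q) (\<lambda>t. deriv p (\<psi> t) * deriv \<psi> t) t = 0"
  proof (rule higher_deriv_mult_comp_zero[where q = "deriv p"])
    show "(deriv ^^ j) (deriv p) (\<psi> t) = 0" if "j \<le> q" for j
      using assms(4)[of "Suc j"] that k by (simp add: funpow_Suc_right del: funpow.simps)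
  qed (use assms(1,2) k in \<open>simp_all add: Ck_real_pred Ck_real_Suc_deriv\<close>)
  ultimately show ?thesis
    using k by (simp add: funpow_Suc_right del: funpow.simps)
qed

text \<open>
  Taylor's theorem with Peano's remainder, for a function whose Taylor polynomial is zero; the
  proof is L'Hopital's rule applied \<open>n\<close> times.
\<close>
lemma vanishing_derivs_imp_little_o:
  assumes "Ck_real n E" "\<And>j. j \<le> n \<Longrightarrow> (deriv ^^ j) E 0 = 0"
  shows "(\<lambda>h. E h / h ^ n) \<midarrow>0\<rightarrow> 0"
  using assms
proof (induction n arbitrary: E)
  case 0
  then have "isCont E 0" by (simp add: Ck_real_0 continuous_on_eq_continuous_at)
  then show ?case using "0.prems"(2)[of 0] by (simp add: isCont_def)
next
  case (Suc n)
  have 1: "(\<lambda>h. deriv E h / h ^ n) \<midarrow>0\<rightarrow> 0"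
  proof (rule Suc.IH)
    show "(deriv ^^ j) (deriv E) 0 = 0" if "j \<le> n" for j
      using Suc.prems(2)[of "Suc j"] that by (simp add: funpow_Suc_right del: funpow.simps)
  qed (use Suc.prems in \<open>simp add: Ck_real_Suc\<close>)
  have D: "(E has_real_derivative deriv E h) (at h)" for h
    using Suc.prems Ck_real_deriv by blast
  show ?case
  proof (rule lhopital[where f' = "deriv E" and g' = "\<lambda>h. real (Suc n) * h ^ n"])
    show "E \<midarrow>0\<rightarrow> 0"
      using DERIV_isCont[OF D, of 0] Suc.prems(2)[of 0] by (simp add: isCont_def)
    show "(\<lambda>h::real. h ^ Suc n) \<midarrow>0\<rightarrow> 0"
      by (auto intro!: tendsto_eq_intros)
    show "\<forall>\<^sub>F h in at 0. (h::real) ^ Suc n \<noteq> 0" "\<forall>\<^sub>F h in at 0. real (Suc n) * h ^ n \<noteq> 0"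
      by (rule eventually_mono[OF eventually_neq_at_within[of 0]]; simp)+
    show "\<forall>\<^sub>F h in at 0. (E has_real_derivative deriv E h) (at h)" using D by simp
    show "\<forall>\<^sub>F h in at 0. ((\<lambda>h. h ^ Suc n) has_real_derivative real (Suc n) * h ^ n) (at h)"
      by (rule always_eventually, rule allI) (use DERIV_pow[of "Suc n"] in \<open>simp del: power_Suc\<close>)
    have "(\<lambda>h. deriv E h / h ^ n * (1 / real (Suc n))) \<midarrow>0\<rightarrow> 0"
      using tendsto_mult_left_zero[OF 1] by blast
    then show "(\<lambda>h. deriv E h / (real (Suc n) * h ^ n)) \<midarrow>0\<rightarrow> 0"
      by (simp add: mult.commute)
  qed
qed

section \<open>Hermite functionals and linear duality\<close>

text \<open>
  Differentiation lowers the multiplicity of a root by exactly one, in characteristic zero.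
\<close>
lemma higher_pderiv_root_power_mult:
  fixes a :: real
  assumes "j \<le> k"
  shows "\<exists>r'. (pderiv ^^ j) ([:-a, 1:] ^ k * r) = [:-a, 1:] ^ (k - j) * r' \<and>
              (poly r a \<noteq> 0 \<longrightarrow> poly r' a \<noteq> 0)"
  using assms
proof (induction j)
  case (Suc j)
  then obtain r' where r': "(pderiv ^^ j) ([:-a, 1:] ^ k * r) = [:-a, 1:] ^ (k - j) * r'"
      "poly r a \<noteq> 0 \<longrightarrow> poly r' a \<noteq> 0" by auto
  define n where "n = k - Suc j"
  have n: "k - j = Suc n" "k - Suc j = n" using Suc.prems by (auto simp: n_def)
  have "pderiv ([:-a, 1:] ^ Suc n * r') =
      [:-a, 1:] ^ n * (smult (of_nat (Suc n)) r' + [:-a, 1:] * pderiv r')"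
    by (simp add: pderiv_mult pderiv_power_Suc pderiv_pCons algebra_simps del: power_Suc)
       (simp add: algebra_simps)
  then show ?case
    using r' n by (intro exI[of _ "smult (of_nat (Suc n)) r' + [:-a, 1:] * pderiv r'"]) auto
qed auto

text \<open>
  Uniqueness in Hermite interpolation, in dual form: no nontrivial combination of the functionals
  \<open>q \<mapsto> q\<^sup>(\<^sup>k\<^sup>) z\<close> with \<open>k < \<mu> z\<close> annihilates all polynomials of degree less than
  \<open>\<Sum>z\<in>Z. \<mu> z\<close>. If \<open>K\<close> is the largest order with \<open>c z K \<noteq> 0\<close>, then
  \<open>(t - z)\<^sup>K \<cdot> (\<Prod>y \<noteq> z. (t - y)\<^bsup>\<mu> y\<^esup>)\<close> is a polynomial on which only the term \<open>(z, K)\<close> survives.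
\<close>
lemma Hermite_functionals_independent_on_polys:
  fixes c :: "real \<Rightarrow> nat \<Rightarrow> real"
  assumes "finite Z"
    and ann: "\<And>q. degree q < sum \<mu> Z \<Longrightarrow>
      (\<Sum>z\<in>Z. \<Sum>k<\<mu> z. c z k * poly ((pderiv ^^ k) q) z) = 0"
    and "z \<in> Z" "k < \<mu> z"
  shows "c z k = 0"
proof (rule ccontr)
  assume "c z k \<noteq> 0"
  \<comment> \<open>orders above \<open>K\<close> at \<open>z\<close> have coefficient zero; orders below \<open>K\<close> do not see \<open>(t - z) ^ K\<close>\<close>
  define K where "K = Max {k. k < \<mu> z \<and> c z k \<noteq> 0}"
  have fin: "finite {k. k < \<mu> z \<and> c z k \<noteq> 0}" by auto
  have K: "K < \<mu> z" "c z K \<noteq> 0"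
    using Max_in[OF fin] \<open>c z k \<noteq> 0\<close> assms(4) unfolding K_def by blast+
  have above: "c z j = 0" if "K < j" "j < \<mu> z" for j
    using Max_ge[OF fin, of j] that unfolding K_def
    by (metis (mono_tags, lifting) leD mem_Collect_eq)
  define r where "r = (\<Prod>y\<in>Z - {z}. [:-y, 1:] ^ \<mu> y)"
  define q where "q = [:-z, 1:] ^ K * r"
  have rz: "poly r z \<noteq> 0"
    using assms(1) by (auto simp: r_def poly_prod)
  have "degree q \<le> K + degree r"
    using degree_mult_le[of "[:-z, 1:] ^ K" r] by (simp add: q_def degree_power_eq)
  also have "degree r = sum \<mu> (Z - {z})"
    unfolding r_def by (subst degree_prod_sum_eq) (auto simp: degree_power_eq)
  also have "K + \<dots> < sum \<mu> Z"
    using K(1) sum.remove[OF assms(1,3), of \<mu>] by simp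
  finally have deg: "degree q < sum \<mu> Z" .
  have other: "poly ((pderiv ^^ j) q) y = 0" if y: "y \<in> Z - {z}" "j < \<mu> y" for y j
  proof -
    have "r = [:-y, 1:] ^ \<mu> y * (\<Prod>x\<in>Z - {z} - {y}. [:-x, 1:] ^ \<mu> x)"
      unfolding r_def using assms(1) y(1) by (intro prod.remove) auto
    then have q: "q = [:-y, 1:] ^ \<mu> y * ([:-z, 1:] ^ K * (\<Prod>x\<in>Z - {z} - {y}. [:-x, 1:] ^ \<mu> x))"
      unfolding q_def by (simp only: mult_ac)
    obtain r' where "(pderiv ^^ j) q = [:-y, 1:] ^ (\<mu> y - j) * r'"
      unfolding q using higher_pderiv_root_power_mult[OF less_imp_le[OF y(2)], of y] by blast
    then show ?thesis using y(2) by (simp add: poly_power)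
  qed
  have same: "poly ((pderiv ^^ j) q) z = 0" if jK: "j < K" for j
  proof -
    obtain r' where "(pderiv ^^ j) q = [:-z, 1:] ^ (K - j) * r'"
      using higher_pderiv_root_power_mult[OF less_imp_le[OF jK], of z r] unfolding q_def by blast
    then show ?thesis using jK by (simp add: poly_power)
  qed
  have last: "poly ((pderiv ^^ K) q) z \<noteq> 0"
  proof -
    obtain r' where "(pderiv ^^ K) q = [:-z, 1:] ^ (K - K) * r'" "poly r' z \<noteq> 0"
      using higher_pderiv_root_power_mult[OF order_refl, of K z r] rz unfolding q_def by blast
    then show ?thesis by simp
  qed
  have "(\<Sum>y\<in>Z. \<Sum>j<\<mu> y. c y j * poly ((pderiv ^^ j) q) y) =
      (\<Sum>j<\<mu> z. c z j * poly ((pderiv ^^ j) q) z)"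
    using assms(1,3) other by (subst sum.remove[of _ z]) auto
  also have "\<dots> = c z K * poly ((pderiv ^^ K) q) z"
  proof -
    have "c z j * poly ((pderiv ^^ j) q) z = 0" if "j \<in> {..<\<mu> z} - {K}" for j
      using that same[of j] above[of j] by (cases "j < K") auto
    then have "(\<Sum>j\<in>{..<\<mu> z} - {K}. c z j * poly ((pderiv ^^ j) q) z) = 0"
      by (intro sum.neutral ballI)
    then show ?thesis using K(1) by (subst sum.remove[of _ K]) auto
  qed
  finally show False using ann[OF deg] K(2) last by simp
qed

text \<open>
  Divide by the largest power of \<open>w\<close> that divides \<open>Q\<close>: the cofactor would tend to \<open>0\<close> at \<open>0\<close>.
\<close>
lemma poly_little_o_imp_zero:
  fixes Q :: "real poly"
  assumes "degree Q \<le> l" "\<And>w. poly Q w = w ^ l * \<epsilon> w" "\<epsilon> \<midarrow>0\<rightarrow> 0"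
  shows "Q = 0"
proof (rule ccontr)
  assume "Q \<noteq> 0"
  then obtain P where P: "Q = [:-0, 1:] ^ order 0 Q * P" "\<not> [:-0, 1:] dvd P"
    using order_decomp by blast
  define n where "n = order 0 Q"
  have n: "n \<le> l" using order_degree[OF \<open>Q \<noteq> 0\<close>, of 0] assms(1) by (simp add: n_def)
  have "poly P w = w ^ (l - n) * \<epsilon> w" if "w \<noteq> 0" for w
  proof -
    have "w ^ n * poly P w = poly Q w"
      by (subst P(1)) (simp add: n_def poly_power)
    also have "\<dots> = w ^ n * (w ^ (l - n) * \<epsilon> w)"
      using n by (simp add: assms(2) mult.assoc[symmetric] flip: power_add)
    finally show ?thesis using that by simp
  qed
  then have ev: "\<forall>\<^sub>F w in at 0. w ^ (l - n) * \<epsilon> w = poly P w"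
    by (auto simp: eventually_at_filter)
  have "(\<lambda>w. w ^ (l - n) * \<epsilon> w) \<midarrow>0\<rightarrow> 0 ^ (l - n) * 0"
    by (intro tendsto_intros assms(3))
  then have "poly P \<midarrow>0\<rightarrow> 0"
    using tendsto_cong[OF ev] by simp
  moreover have "poly P \<midarrow>0\<rightarrow> poly P 0" using isCont_def poly_isCont by blast
  ultimately have "poly P 0 = 0" using LIM_unique by blast
  then show False using P(2) by (simp add: poly_eq_0_iff_dvd)
qed

text \<open>
  The same independence holds on the dilates \<open>t \<mapsto> \<sigma> (w * t + s)\<close> in place of the polynomials.
  Write \<open>\<Lambda>\<close> for the combination of functionals. Taylor expansion of \<open>\<sigma>\<close> at \<open>s\<close> gives
  \<open>\<Lambda> (\<sigma> (w * t + s)) = (\<Sum>j\<le>l. \<sigma>\<^sup>(\<^sup>j\<^sup>) s / j! * \<Lambda> (t\<^sup>j) * w\<^sup>j) + o(w\<^sup>l)\<close> as \<open>w \<rightarrow> 0\<close>. If the left side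
  vanishes for all \<open>w\<close>, then so do all coefficients, and as no \<open>\<sigma>\<^sup>(\<^sup>j\<^sup>) s\<close> is zero, \<open>\<Lambda>\<close> kills
  every monomial of degree at most \<open>l\<close>.
\<close>
lemma Hermite_functionals_independent_on_dilates:
  fixes c :: "real \<Rightarrow> nat \<Rightarrow> real"
  assumes "finite Z" "Ck_real l \<sigma>" "\<And>j. j \<le> l \<Longrightarrow> (deriv ^^ j) \<sigma> s \<noteq> 0"
    and size: "sum \<mu> Z = Suc l"
    and ann: "\<And>w. (\<Sum>z\<in>Z. \<Sum>k<\<mu> z. c z k * (deriv ^^ k) (\<lambda>t. \<sigma> (w * t + s)) z) = 0"
    and "z \<in> Z" "k < \<mu> z"
  shows "c z k = 0"
proof -
  define \<Lambda> where "\<Lambda> q = (\<Sum>z\<in>Z. \<Sum>k<\<mu> z. c z k * poly ((pderiv ^^ k) q) z)" for q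
  have \<mu>: "k \<le> l" if "z \<in> Z" "k < \<mu> z" for z k
    using member_le_sum[of z Z \<mu>] that assms(1) size by simp
  \<comment> \<open>the Taylor polynomial of \<open>\<sigma>\<close> at \<open>s\<close>, as a polynomial in the increment\<close>
  define T where "T = (\<Sum>j\<le>l. monom ((deriv ^^ j) \<sigma> s / fact j) j)"
  have coeff_T: "coeff T j = (if j \<le> l then (deriv ^^ j) \<sigma> s / fact j else 0)" for j
    by (simp add: T_def coeff_sum)
  have T_derivs: "poly ((pderiv ^^ j) T) 0 = (deriv ^^ j) \<sigma> s" if "j \<le> l" for j
  proof -
    have "poly ((pderiv ^^ j) T) 0 = pochhammer 1 j * coeff T j"
      by (simp add: poly_0_coeff_0 coeff_higher_pderiv)
    also have "\<dots> = (deriv ^^ j) \<sigma> s"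
      using that by (simp add: coeff_T flip: pochhammer_fact)
    finally show ?thesis .
  qed
  define E where "E h = \<sigma> (1 * h + s) - poly T h" for h
  have \<sigma>s: "Ck_real l (\<lambda>h. \<sigma> (1 * h + s))"
    by (rule Ck_real_compose[OF assms(2) Ck_real_affine])
  have E_eq: "E = (\<lambda>h. 1 * \<sigma> (1 * h + s) + (-1) * poly T h)"
    by (auto simp: E_def)
  have CE: "Ck_real l E"
    unfolding E_eq by (rule Ck_real_lincomb[OF \<sigma>s Ck_real_poly])
  have dE: "(deriv ^^ k) E h = (deriv ^^ k) \<sigma> (h + s) - poly ((pderiv ^^ k) T) h" if "k \<le> l" for k h
    unfolding E_eq higher_deriv_lincomb[OF \<sigma>s Ck_real_poly that]
      higher_deriv_affine[OF assms(2) that] higher_deriv_poly by simp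
  \<comment> \<open>the relative error; at \<open>0\<close> its value is \<open>0\<close> (by division by zero if \<open>k < l\<close>), so it is continuous there\<close>
  define \<rho> where "\<rho> k h = (deriv ^^ k) E h / h ^ (l - k)" for k h
  have E0: "(deriv ^^ j) E 0 = 0" if "j \<le> l" for j
    using that by (simp add: dE T_derivs)
  have \<rho>: "\<rho> k \<midarrow>0\<rightarrow> 0" "\<rho> k 0 = 0" "(deriv ^^ k) E h = h ^ (l - k) * \<rho> k h" if "k \<le> l" for k h
  proof -
    show "\<rho> k \<midarrow>0\<rightarrow> 0"
      unfolding \<rho>_def
    proof (rule vanishing_derivs_imp_little_o)
      show "Ck_real (l - k) ((deriv ^^ k) E)"
        using CE that by (intro Ck_real_higher_deriv) simp
      show "(deriv ^^ j) ((deriv ^^ k) E) 0 = 0" if "j \<le> l - k" for j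
        using E0[of "j + k"] that \<open>k \<le> l\<close> by (simp add: funpow_add)
    qed
    show "\<rho> k 0 = 0" using E0[OF that] by (simp add: \<rho>_def)
    show "(deriv ^^ k) E h = h ^ (l - k) * \<rho> k h"
      using E0[OF that] by (cases "h = 0") (auto simp: \<rho>_def)
  qed
  have cont: "(\<lambda>w. \<rho> k (w * z)) \<midarrow>0\<rightarrow> 0" if "k \<le> l" for k z
  proof -
    have "isCont (\<rho> k) (0 * z)" using \<rho>(1,2)[OF that] by (simp add: isCont_def)
    then have "isCont (\<lambda>w. \<rho> k (w * z)) 0"
      by (rule isCont_o2[where f = "\<lambda>w. w * z", rotated]) simp
    then show ?thesis using \<rho>(2)[OF that] by (simp add: isCont_def)
  qed
  \<comment> \<open>\<open>Q\<close> is the polynomial part of the expansion of \<open>\<Lambda>\<close> in \<open>w\<close>, \<open>w ^ l * \<epsilon> w\<close> is minus the remainder\<close>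
  define \<epsilon> where "\<epsilon> w = - (\<Sum>z\<in>Z. \<Sum>k<\<mu> z. c z k * (z ^ (l - k) * \<rho> k (w * z)))" for w
  have \<epsilon>: "\<epsilon> \<midarrow>0\<rightarrow> 0"
  proof -
    have "\<epsilon> \<midarrow>0\<rightarrow> - (\<Sum>z\<in>Z. \<Sum>k<\<mu> z. c z k * (z ^ (l - k) * 0))"
      unfolding \<epsilon>_def
      by (intro tendsto_minus tendsto_sum tendsto_mult tendsto_const cont) (use \<mu> in auto)
    then show ?thesis by simp
  qed
  define Q where "Q = (\<Sum>j\<le>l. monom (coeff T j * \<Lambda> (monom 1 j)) j)"
  \<comment> \<open>both sides are the \<open>k\<close>-th derivative at \<open>z\<close> of the dilated Taylor polynomial \<open>t \<mapsto> T (w * t)\<close>\<close>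
  have T_dil: "w ^ k * poly ((pderiv ^^ k) T) (w * z) =
      (\<Sum>j\<le>l. coeff T j * w ^ j * poly ((pderiv ^^ k) (monom 1 j)) z)" for w z k
  proof -
    have dil: "w ^ k * poly ((pderiv ^^ k) (monom a j)) (w * z) =
        a * w ^ j * poly ((pderiv ^^ k) (monom 1 j)) z" for a j
    proof -
      have eq: "(\<lambda>t. poly (monom a j) (w * t + 0)) = poly (smult (a * w ^ j) (monom 1 j))"
        by (auto simp: poly_monom power_mult_distrib)
      have "w ^ k * poly ((pderiv ^^ k) (monom a j)) (w * z) =
          (deriv ^^ k) (\<lambda>t. poly (monom a j) (w * t + 0)) z"
        by (subst higher_deriv_affine[OF Ck_real_poly order_refl]) (simp add: higher_deriv_poly)
      then show ?thesis
        unfolding eq by (simp only: higher_deriv_poly higher_pderiv_smult poly_smult)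
    qed
    have "(\<Sum>j\<le>l. monom (coeff T j) j) = T"
      unfolding coeff_T unfolding T_def by simp
    then have "w ^ k * poly ((pderiv ^^ k) T) (w * z) =
        w ^ k * poly ((pderiv ^^ k) (\<Sum>j\<le>l. monom (coeff T j) j)) (w * z)" by presburger
    then show ?thesis by (simp only: higher_pderiv_sum poly_sum sum_distrib_left dil)
  qed
  have Q: "poly Q w = w ^ l * \<epsilon> w" for w
  proof -
    have expand: "w ^ k * (deriv ^^ k) \<sigma> (w * z + s) =
        (\<Sum>j\<le>l. coeff T j * w ^ j * poly ((pderiv ^^ k) (monom 1 j)) z) +
        w ^ l * (z ^ (l - k) * \<rho> k (w * z))" if "k \<le> l" for z k
    proof -
      have "w ^ l = w ^ k * w ^ (l - k)" using that by (simp flip: power_add)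
      moreover have "(deriv ^^ k) \<sigma> (w * z + s) =
          poly ((pderiv ^^ k) T) (w * z) + (w * z) ^ (l - k) * \<rho> k (w * z)"
        using dE[OF that, of "w * z"] \<rho>(3)[OF that, of "w * z"] by linarith
      ultimately show ?thesis
        unfolding T_dil[symmetric] by (simp add: power_mult_distrib distrib_left mult.assoc)
    qed
    have "0 = (\<Sum>z\<in>Z. \<Sum>k<\<mu> z. c z k * (deriv ^^ k) (\<lambda>t. \<sigma> (w * t + s)) z)"
      using ann[of w] by simp
    also have "\<dots> = (\<Sum>z\<in>Z. \<Sum>k<\<mu> z. c z k *
        (\<Sum>j\<le>l. coeff T j * w ^ j * poly ((pderiv ^^ k) (monom 1 j)) z) +
        w ^ l * (c z k * (z ^ (l - k) * \<rho> k (w * z))))"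
    proof (intro sum.cong refl)
      fix z k assume "z \<in> Z" "k \<in> {..<\<mu> z}"
      then have k: "k \<le> l" using \<mu> by simp
      show "c z k * (deriv ^^ k) (\<lambda>t. \<sigma> (w * t + s)) z = c z k *
        (\<Sum>j\<le>l. coeff T j * w ^ j * poly ((pderiv ^^ k) (monom 1 j)) z) +
        w ^ l * (c z k * (z ^ (l - k) * \<rho> k (w * z)))"
        unfolding higher_deriv_affine[OF assms(2) k] expand[OF k]
        by (simp only: distrib_left mult.left_commute)
    qed
    also have "\<dots> = (\<Sum>z\<in>Z. \<Sum>k<\<mu> z. c z k *
        (\<Sum>j\<le>l. coeff T j * w ^ j * poly ((pderiv ^^ k) (monom 1 j)) z)) - w ^ l * \<epsilon> w"
      by (simp only: \<epsilon>_def sum.distrib sum_distrib_left[symmetric])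
    also have "(\<Sum>z\<in>Z. \<Sum>k<\<mu> z. c z k *
        (\<Sum>j\<le>l. coeff T j * w ^ j * poly ((pderiv ^^ k) (monom 1 j)) z)) = poly Q w"
    proof -
      have "(\<Sum>z\<in>Z. \<Sum>k<\<mu> z. c z k *
          (\<Sum>j\<le>l. coeff T j * w ^ j * poly ((pderiv ^^ k) (monom 1 j)) z)) =
        (\<Sum>z\<in>Z. \<Sum>j\<le>l. \<Sum>k<\<mu> z. c z k * (coeff T j * w ^ j * poly ((pderiv ^^ k) (monom 1 j)) z))"
        unfolding sum_distrib_left by (rule sum.cong[OF refl], rule sum.swap)
      also have "\<dots> = (\<Sum>j\<le>l. \<Sum>z\<in>Z. \<Sum>k<\<mu> z.
          c z k * (coeff T j * w ^ j * poly ((pderiv ^^ k) (monom 1 j)) z))"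
        by (rule sum.swap)
      also have "\<dots> = (\<Sum>j\<le>l. coeff T j * \<Lambda> (monom 1 j) * w ^ j)"
        unfolding \<Lambda>_def sum_distrib_left sum_distrib_right by (intro sum.cong refl) simp
      also have "\<dots> = poly Q w"
        by (simp add: Q_def poly_sum poly_monom)
      finally show ?thesis .
    qed
    finally show ?thesis by simp
  qed
  have "Q = 0"
  proof (rule poly_little_o_imp_zero[OF _ Q \<epsilon>])
    show "degree Q \<le> l"
      unfolding Q_def by (rule degree_sum_le) (auto intro: order.trans[OF degree_monom_le])
  qed
  have mono: "\<Lambda> (monom 1 j) = 0" if "j \<le> l" for j
  proof -
    have "coeff Q j = coeff T j * \<Lambda> (monom 1 j)"
      using that by (simp add: Q_def coeff_sum)
    then show ?thesis using \<open>Q = 0\<close> that assms(3) by (simp add: coeff_T)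
  qed
  show ?thesis
  proof (rule Hermite_functionals_independent_on_polys[where \<mu> = \<mu> and c = c, OF assms(1) _ assms(6,7)])
    fix q :: "real poly"
    assume "degree q < sum \<mu> Z"
    then have deg: "degree q \<le> l" using size by simp
    have q: "(\<Sum>j\<le>l. smult (coeff q j) (monom 1 j)) = q"
      using poly_as_sum_of_monoms'[OF deg] by (simp add: smult_monom)
    have "poly ((pderiv ^^ k) q) z = (\<Sum>j\<le>l. coeff q j * poly ((pderiv ^^ k) (monom 1 j)) z)" for k z
      by (subst (1) q[symmetric]) (simp only: higher_pderiv_sum higher_pderiv_smult poly_sum poly_smult)
    then have "\<Lambda> q = (\<Sum>z\<in>Z. \<Sum>k<\<mu> z. \<Sum>j\<le>l. coeff q j * (c z k * poly ((pderiv ^^ k) (monom 1 j)) z))"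
      unfolding \<Lambda>_def by (simp add: sum_distrib_left mult.left_commute)
    also have "\<dots> = (\<Sum>z\<in>Z. \<Sum>j\<le>l. \<Sum>k<\<mu> z. coeff q j * (c z k * poly ((pderiv ^^ k) (monom 1 j)) z))"
      by (rule sum.cong[OF refl], rule sum.swap)
    also have "\<dots> = (\<Sum>j\<le>l. \<Sum>z\<in>Z. \<Sum>k<\<mu> z. coeff q j * (c z k * poly ((pderiv ^^ k) (monom 1 j)) z))"
      by (rule sum.swap)
    also have "\<dots> = (\<Sum>j\<le>l. coeff q j * \<Lambda> (monom 1 j))"
      unfolding \<Lambda>_def by (simp add: sum_distrib_left)
    also have "\<dots> = 0" using mono by simp
    finally show "(\<Sum>z\<in>Z. \<Sum>k<\<mu> z. c z k * poly ((pderiv ^^ k) q) z) = 0"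
      by (simp add: \<Lambda>_def)
  qed
qed

text \<open>
  Finite-dimensional duality: a linear space of real families on \<open>I\<close> which no nonzero functional
  annihilates contains, up to values off \<open>I\<close>, every family. In the induction step the functional
  \<open>f \<mapsto> f j - (\<Sum>k\<in>I. f k * e k j)\<close>, for a dual basis \<open>e\<close> on \<open>I\<close>, is nonzero, so some member of
  the space can be corrected to one that vanishes on \<open>I\<close> and not at \<open>j\<close>.
\<close>
lemma interpolation_of_no_annihilator:
  fixes V :: "('i \<Rightarrow> real) set"
  assumes "finite I" "V \<noteq> {}"
    and lin: "\<And>f g a b. f \<in> V \<Longrightarrow> g \<in> V \<Longrightarrow> (\<lambda>i. a * f i + b * g i) \<in> V"
    and "\<And>c i. (\<And>f. f \<in> V \<Longrightarrow> (\<Sum>i\<in>I. c i * f i) = 0) \<Longrightarrow> i \<in> I \<Longrightarrow> c i = 0"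
  shows "\<exists>f\<in>V. \<forall>i\<in>I. f i = y i"
  using assms(1,4)
proof (induction I arbitrary: y rule: finite_induct)
  case empty
  then show ?case using assms(2) by auto
next
  case (insert j I)
  have IH: "\<exists>f\<in>V. \<forall>i\<in>I. f i = y i" for y
  proof (rule insert.IH)
    fix c i assume c: "\<And>f. f \<in> V \<Longrightarrow> (\<Sum>i\<in>I. c i * f i) = 0" and i: "i \<in> I"
    have "(if i = j then 0 else c i) = 0"
    proof (rule insert.prems)
      fix f assume "f \<in> V"
      have "(\<Sum>k\<in>I. (if k = j then 0 else c k) * f k) = (\<Sum>k\<in>I. c k * f k)"
        using insert.hyps by (intro sum.cong) auto
      then show "(\<Sum>k\<in>insert j I. (if k = j then 0 else c k) * f k) = 0"
        using insert.hyps c[OF \<open>f \<in> V\<close>] by simp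
    qed (use i in simp)
    then show "c i = 0" using i insert.hyps by (auto split: if_splits)
  qed
  have sumV: "(\<lambda>i. \<Sum>k\<in>K. a k * e k i) \<in> V" if "finite K" "\<And>k. k \<in> K \<Longrightarrow> e k \<in> V"
    for K and a :: "'i \<Rightarrow> real" and e
    using that
  proof (induction K rule: finite_induct)
    case empty
    obtain f where "f \<in> V" using assms(2) by auto
    then show ?case using lin[of f f 0 0] by simp
  next
    case (insert k K)
    then show ?case using lin[of "e k" "\<lambda>i. \<Sum>k\<in>K. a k * e k i" "a k" 1] by simp
  qed
  have "\<forall>k. \<exists>f\<in>V. \<forall>i\<in>I. f i = (if i = k then 1 else 0)"
    by (intro allI IH)
  then obtain e where e: "\<And>k. e k \<in> V" "\<And>k i. i \<in> I \<Longrightarrow> e k i = (if i = k then 1 else 0)"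
    by metis
  have "\<exists>f\<in>V. f j \<noteq> (\<Sum>k\<in>I. f k * e k j)"
  proof (rule ccontr)
    assume *: "\<not> ?thesis"
    have "(if j = j then 1 else - e j j) = (0::real)"
    proof (rule insert.prems[of "\<lambda>k. if k = j then 1 else - e k j"])
      fix f assume "f \<in> V"
      have "(\<Sum>k\<in>I. (if k = j then 1 else - e k j) * f k) = (\<Sum>k\<in>I. - (f k * e k j))"
        using insert.hyps by (intro sum.cong) auto
      then show "(\<Sum>k\<in>insert j I. (if k = j then 1 else - e k j) * f k) = 0"
        using insert.hyps * \<open>f \<in> V\<close> by (auto simp: sum_negf)
    qed simp
    then show False by simp
  qed
  then obtain f where f: "f \<in> V" "f j \<noteq> (\<Sum>k\<in>I. f k * e k j)" by auto
  define g where "g i = 1 * f i + (-1) * (\<Sum>k\<in>I. f k * e k i)" for i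
  have g: "g \<in> V" "g j \<noteq> 0" "\<And>i. i \<in> I \<Longrightarrow> g i = 0"
  proof -
    have "(\<lambda>i. 1 * f i + (-1) * (\<Sum>k\<in>I. f k * e k i)) \<in> V"
      by (intro lin f(1) sumV insert.hyps(1) e(1))
    moreover have "g = (\<lambda>i. 1 * f i + (-1) * (\<Sum>k\<in>I. f k * e k i))"
      by (simp add: g_def fun_eq_iff)
    ultimately show "g \<in> V" by simp
    show "g j \<noteq> 0" using f(2) by (simp add: g_def)
    show "g i = 0" if "i \<in> I" for i
    proof -
      have "(\<Sum>k\<in>I. f k * e k i) = (\<Sum>k\<in>I. if i = k then f k else 0)"
        using e(2)[OF that] by (intro sum.cong) auto
      then show ?thesis using that insert.hyps(1) by (simp add: g_def)
    qed
  qed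
  obtain h where h: "h \<in> V" "\<forall>i\<in>I. h i = y i" using IH by blast
  show ?case
  proof (rule bexI)
    show "(\<lambda>i. 1 * h i + (y j - h j) / g j * g i) \<in> V" by (rule lin[OF h(1) g(1)])
    show "\<forall>i\<in>insert j I. 1 * h i + (y j - h j) / g j * g i = y i"
      using h(2) g(2,3) by simp
  qed
qed

section \<open>Networks that are ridge functions\<close>

text \<open>
  The functions of one real variable that one hidden layer realises. The width \<open>n\<close> is positive
  because the hidden layers of a network are nonempty; zero outer weights are allowed.
\<close>
definition shallow :: "(real \<Rightarrow> real) \<Rightarrow> (real \<Rightarrow> real) set" where
  "shallow \<sigma> = {p. \<exists>n\<ge>1::nat. \<exists>a w b c. p = (\<lambda>z. (\<Sum>j<n. a j * \<sigma> (w j * z + b j)) + c)}"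

lemma shallowI: "n \<ge> (1::nat) \<Longrightarrow> (\<lambda>z. (\<Sum>j<n. a j * \<sigma> (w j * z + b j)) + c) \<in> shallow \<sigma>"
  unfolding shallow_def by blast

lemma shallowE:
  assumes "p \<in> shallow \<sigma>"
  obtains n :: nat and a w b c where "n \<ge> 1" "p = (\<lambda>z. (\<Sum>j<n. a j * \<sigma> (w j * z + b j)) + c)"
  using assms unfolding shallow_def by blast

lemma shallow_unit: "(\<lambda>z. \<sigma> (w * z + b)) \<in> shallow \<sigma>"
  using shallowI[of 1 "\<lambda>_. 1" \<sigma> "\<lambda>_. w" "\<lambda>_. b" 0] by simp

lemma shallow_const: "(\<lambda>z. c) \<in> shallow \<sigma>"
  using shallowI[of 1 "\<lambda>_. 0" \<sigma> "\<lambda>_. 0" "\<lambda>_. 0" c] by simp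

lemma shallow_lincomb:
  assumes "p \<in> shallow \<sigma>" "q \<in> shallow \<sigma>"
  shows "(\<lambda>z. r * p z + s * q z) \<in> shallow \<sigma>"
proof -
  obtain n :: nat and a w b c where n: "n \<ge> 1"
      and p: "p = (\<lambda>z. (\<Sum>j<n. a j * \<sigma> (w j * z + b j)) + c)"
    using assms(1) by (rule shallowE)
  obtain n' :: nat and a' w' b' c' where q: "q = (\<lambda>z. (\<Sum>j<n'. a' j * \<sigma> (w' j * z + b' j)) + c')"
    using assms(2) by (rule shallowE)
  define A where "A j = (if j < n then r * a j else s * a' (j - n))" for j
  define W where "W j = (if j < n then w j else w' (j - n))" for j
  define B where "B j = (if j < n then b j else b' (j - n))" for j
  have "(\<Sum>j<n + k. A j * \<sigma> (W j * z + B j)) = r * (\<Sum>j<n. a j * \<sigma> (w j * z + b j)) +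
      s * (\<Sum>j<k. a' j * \<sigma> (w' j * z + b' j))" for k z
    by (induction k) (simp_all add: A_def W_def B_def sum_distrib_left distrib_left mult.assoc)
  then have "(\<lambda>z. r * p z + s * q z) =
      (\<lambda>z. (\<Sum>j<n + n'. A j * \<sigma> (W j * z + B j)) + (r * c + s * c'))"
    by (simp add: p q distrib_left algebra_simps)
  then show ?thesis using shallowI[of "n + n'" A \<sigma> W B "r * c + s * c'"] n by simp
qed

lemma shallow_sum:
  assumes "finite K" "\<And>k. k \<in> K \<Longrightarrow> p k \<in> shallow \<sigma>"
  shows "(\<lambda>z. \<Sum>k\<in>K. a k * p k z) \<in> shallow \<sigma>"
  using assms
proof (induction K rule: finite_induct)
  case empty
  show ?case using shallow_const[of 0] by simp
next
  case (insert k K)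
  then show ?case
    using shallow_lincomb[of "p k" \<sigma> "\<lambda>z. \<Sum>k\<in>K. a k * p k z" "a k" 1] by simp
qed

lemma shallow_Ck:
  assumes "Ck_real r \<sigma>" "p \<in> shallow \<sigma>"
  shows "Ck_real r p"
proof -
  obtain n :: nat and a w b c where p: "p = (\<lambda>z. (\<Sum>j<n. a j * \<sigma> (w j * z + b j)) + c)"
    using assms(2) by (rule shallowE)
  have "Ck_real r (\<lambda>z. (\<Sum>j<n. a j * \<sigma> (w j * z + b j)) + c)"
  proof (induction n)
    case 0
    show ?case using Ck_real_const by simp
  next
    case (Suc n)
    have "Ck_real r (\<lambda>z. 1 * ((\<Sum>j<n. a j * \<sigma> (w j * z + b j)) + c) + a n * \<sigma> (w n * z + b n))"
      by (rule Ck_real_lincomb[OF Suc Ck_real_compose[OF assms(1) Ck_real_affine]])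
    then show ?case by (simp add: algebra_simps)
  qed
  then show ?thesis unfolding p .
qed

text \<open>
  The first hidden layer forms \<open>v \<bullet> x + \<beta>\<close>; all hidden layers before the last one have width one
  and only apply \<open>\<sigma>\<close>, \<open>L - 2\<close> times in total; the last hidden layer and the output realise \<open>p\<close>.
\<close>
lemma ridge_network:
  fixes v :: "real ^ 'n"
  assumes "L \<ge> 2" "p \<in> shallow \<sigma>"
  shows "(\<lambda>x. p ((\<sigma> ^^ (L - 2)) (v \<bullet> x + \<beta>))) \<in> neural_networks \<sigma> L"
proof -
  obtain n :: nat and a \<omega> b c where n: "n \<ge> 1"
      and p: "p = (\<lambda>z. (\<Sum>j<n. a j * \<sigma> (\<omega> j * z + b j)) + c)"
    using assms(2) by (rule shallowE)
  define w where "w i = (if i = 0 then CARD('n) else if i = L - 1 then n else 1)" for i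
  \<comment> \<open>\<open>A i\<close> and \<open>B i\<close> form the scalar that layer \<open>i\<close> reads from its predecessor, so that the case
    \<open>L = 2\<close>, where the last hidden layer reads the input, is covered as well\<close>
  define A where "A i k = (if i = 1 then v $ from_nat_into UNIV k else (1::real))" for i k :: nat
  define B where "B i = (if i = 1 then \<beta> else 0)" for i :: nat
  define W where "W i j k = (if i = L then a k else if i = L - 1 then \<omega> j * A i k else A i k)"
    for i j k :: nat
  define b' where "b' i j = (if i = L then c else if i = L - 1 then \<omega> j * B i + b j else B i)"
    for i j :: nat
  have width: "w 0 = CARD('n)" "w (L - 1) = n" "i \<noteq> 0 \<Longrightarrow> i \<noteq> L - 1 \<Longrightarrow> w i = 1" for i
    using assms(1) by (auto simp: w_def)
  have mid: "W i j k = A i k" "b' i j = B i" if "i \<noteq> L" "i \<noteq> L - 1" for i j k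
    using that by (simp_all add: W_def b'_def)
  have pen: "W (L - 1) j k = \<omega> j * A (L - 1) k" "b' (L - 1) j = \<omega> j * B (L - 1) + b j" for j k
    using assms(1) by (auto simp: W_def b'_def)
  have out: "W L j k = a k" "b' L j = c" for j k
    by (simp_all add: W_def b'_def)
  have input: "(\<Sum>k<CARD('n). v $ from_nat_into UNIV k * x $ from_nat_into UNIV k) = v \<bullet> x"
    for x :: "real ^ 'n"
    unfolding inner_vec_def inner_real_def
    by (rule sum.reindex_bij_betw[OF bij_betw_from_nat_into_finite[OF finite]])
  have pre: "(\<Sum>k<w i. A (Suc i) k * hidden_layer \<sigma> w W b' i x k) + B (Suc i) = (\<sigma> ^^ i) (v \<bullet> x + \<beta>)"
    if "Suc i \<le> L - 1" for i and x :: "real ^ 'n"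
    using that
  proof (induction i)
    case 0
    show ?case using input[of x] by (simp add: A_def B_def width)
  next
    case (Suc i)
    have L: "Suc i \<noteq> L" "Suc i \<noteq> L - 1" "i \<noteq> L - 1" using Suc.prems by auto
    have "affine_layer w W b' (Suc i) (hidden_layer \<sigma> w W b' i x) 0 = (\<sigma> ^^ i) (v \<bullet> x + \<beta>)"
      using Suc L by (simp add: affine_layer_def mid)
    then show ?case using L by (simp add: A_def B_def width)
  qed
  have last: "hidden_layer \<sigma> w W b' (L - 1) x j = \<sigma> (\<omega> j * (\<sigma> ^^ (L - 2)) (v \<bullet> x + \<beta>) + b j)"
    for j and x :: "real ^ 'n"
  proof -
    have L: "L - 1 = Suc (L - 2)" using assms(1) by simp
    have "\<omega> j * (\<sigma> ^^ (L - 2)) (v \<bullet> x + \<beta>) + b j =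
        affine_layer w W b' (L - 1) (hidden_layer \<sigma> w W b' (L - 2) x) j"
      unfolding affine_layer_def pen using pre[of "L - 2" x, symmetric] L
      by (simp add: distrib_left sum_distrib_left mult.assoc)
    then show ?thesis unfolding L by simp
  qed
  have "affine_layer w W b' L (hidden_layer \<sigma> w W b' (L - 1) x) 0 = p ((\<sigma> ^^ (L - 2)) (v \<bullet> x + \<beta>))"
    for x :: "real ^ 'n"
    unfolding affine_layer_def last p out width ..
  then show ?thesis
    unfolding neural_networks_def using assms(1) n
    by (intro CollectI exI[of _ w] exI[of _ W] exI[of _ b']) (auto simp: w_def)
qed

section \<open>Derivatives of ridge functions\<close>

text \<open>
  Partial derivatives of \<open>c * F (v \<bullet> y)\<close> have the same form, with \<open>F'\<close> for \<open>F\<close>. Requiring this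
  form only on an open set makes the lemma apply repeatedly to restricted functions and to
  functions that are ridge functions near a point only.
\<close>
lemma partial_deriv_ridge:
  fixes u :: "real ^ 'n \<Rightarrow> real"
  assumes "open U" "\<And>y. y \<in> U \<Longrightarrow> u y = c * F (v \<bullet> y)" "Ck_real (Suc r) F" "x \<in> U"
  shows "partial_deriv i u x = (c * v $ i) * deriv F (v \<bullet> x)"
proof -
  have "((\<lambda>t. x + t *\<^sub>R axis i 1) \<longlongrightarrow> x + 0 *\<^sub>R axis i 1) (nhds 0)"
    by (intro tendsto_intros filterlim_ident)
  then have "\<forall>\<^sub>F t in nhds 0. x + t *\<^sub>R axis i 1 \<in> U"
    using assms(1,4) by (auto simp: tendsto_def)
  then have "\<forall>\<^sub>F t in nhds 0. u (x + t *\<^sub>R axis i 1) = c * F (v \<bullet> x + t * v $ i)"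
    by eventually_elim (simp add: assms(2) inner_add_right inner_axis)
  then have "partial_deriv i u x = deriv (\<lambda>t. c * F (v \<bullet> x + t * v $ i)) 0"
    unfolding partial_deriv_def by (rule deriv_cong_ev) simp
  also have "((\<lambda>t. F (v \<bullet> x + t * v $ i)) has_real_derivative deriv F (v \<bullet> x + 0 * v $ i) * v $ i) (at 0)"
    by (rule DERIV_chain2[OF Ck_real_deriv[OF assms(3)]]) (auto intro!: derivative_eq_intros)
  then have "deriv (\<lambda>t. c * F (v \<bullet> x + t * v $ i)) 0 = c * (deriv F (v \<bullet> x + 0 * v $ i) * v $ i)"
    by (intro DERIV_imp_deriv DERIV_cmult)
  finally show ?thesis by simp
qed

lemma Ck_on_ridge:
  fixes u :: "real ^ 'n \<Rightarrow> real"
  assumes "open U" "\<And>y. y \<in> U \<Longrightarrow> u y = c * F (v \<bullet> y)" "Ck_real r F"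
  shows "Ck_on r u U"
  using assms(2,3)
proof (induction r arbitrary: u c F)
  case 0
  have "continuous_on U (F \<circ> (\<lambda>y. v \<bullet> y))"
    using 0(2) by (intro continuous_on_compose continuous_intros)
      (auto simp: Ck_real_0 intro: continuous_on_subset)
  then have "continuous_on U (\<lambda>y. c * F (v \<bullet> y))"
    by (intro continuous_on_mult_left) (simp add: comp_def)
  then show ?case using 0 by (simp cong: continuous_on_cong)
next
  case (Suc r)
  have "u differentiable_on U"
    unfolding differentiable_on_def
  proof
    fix y assume y: "y \<in> U"
    have "(F has_derivative (\<lambda>h. deriv F (v \<bullet> y) * h)) (at (v \<bullet> y))"
      using Ck_real_deriv[OF Suc.prems(2)] by (simp add: has_field_derivative_def)
    moreover have "((\<lambda>y. v \<bullet> y) has_derivative (\<lambda>h. v \<bullet> h)) (at y within U)"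
      by (auto intro!: derivative_eq_intros)
    ultimately have "((\<lambda>y. F (v \<bullet> y)) has_derivative (\<lambda>h. deriv F (v \<bullet> y) * (v \<bullet> h))) (at y within U)"
      by (rule has_derivative_compose[rotated])
    then have "((\<lambda>y. c * F (v \<bullet> y)) has_derivative (\<lambda>h. c * (deriv F (v \<bullet> y) * (v \<bullet> h)))) (at y within U)"
      by (rule has_derivative_mult_right)
    then have "(u has_derivative (\<lambda>h. c * (deriv F (v \<bullet> y) * (v \<bullet> h)))) (at y within U)"
      by (rule has_derivative_transform[OF y, rotated]) (simp add: Suc.prems(1))
    then show "u differentiable (at y within U)"
      unfolding differentiable_def by blast
  qed
  moreover have "Ck_on r (partial_deriv i u) U" for i
    by (rule Suc.IH[where c = "c * v $ i" and F = "deriv F"])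
      (use partial_deriv_ridge[OF assms(1) Suc.prems] Ck_real_Suc_deriv[OF Suc.prems(2)] in auto)
  ultimately show ?case by simp
qed

text \<open>
  The constant is the monomial \<open>\<Prod>i. (v $ i) ^ \<beta> i\<close>. Existence of some constant
  suffices to carry zeros of the derivatives of \<open>F\<close> over to \<open>u\<close>.
\<close>
lemma multi_deriv_ridge:
  fixes u :: "real ^ 'n \<Rightarrow> real"
  assumes "open U" "\<And>y. y \<in> U \<Longrightarrow> u y = F (v \<bullet> y)" "Ck_real (sum \<beta> UNIV) F" "x \<in> U"
  shows "\<exists>c. multi_deriv \<beta> u x = c * (deriv ^^ sum \<beta> UNIV) F (v \<bullet> x)"
proof -
  have iter: "\<exists>c'. \<forall>y\<in>U. (partial_deriv i ^^ k) u y = c' * (deriv ^^ k) F (v \<bullet> y)"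
    if "\<And>y. y \<in> U \<Longrightarrow> u y = c * F (v \<bullet> y)" "Ck_real k F" for i k c F and u :: "real ^ 'n \<Rightarrow> real"
    using that
  proof (induction k arbitrary: u c F)
    case (Suc k)
    show ?case
      using Suc.IH[OF partial_deriv_ridge[OF assms(1) Suc.prems] Ck_real_Suc_deriv[OF Suc.prems(2)]]
      by (simp add: funpow_Suc_right del: funpow.simps)
  qed auto
  have list: "\<exists>c. \<forall>y\<in>U. foldr (\<lambda>i v. (partial_deriv i ^^ \<beta> i) v) xs u y =
      c * (deriv ^^ sum_list (map \<beta> xs)) F (v \<bullet> y)"
    if "Ck_real (sum_list (map \<beta> xs)) F" for xs
    using that
  proof (induction xs)
    case Nil
    then show ?case using assms(2) by (auto intro!: exI[of _ 1])
  next
    case (Cons i xs)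
    let ?S = "sum_list (map \<beta> xs)"
    have C: "Ck_real (?S + \<beta> i) F" using Cons.prems by (simp add: add.commute)
    obtain c where c: "\<And>y. y \<in> U \<Longrightarrow>
        foldr (\<lambda>i v. (partial_deriv i ^^ \<beta> i) v) xs u y = c * (deriv ^^ ?S) F (v \<bullet> y)"
      using Cons.IH Ck_real_mono[OF C] by auto
    show ?case
      using iter[OF c Ck_real_higher_deriv[OF C], of i] by (simp add: funpow_add)
  qed
  have bij: "bij_betw (from_nat_into UNIV) {..<CARD('n)} (UNIV :: 'n set)"
    by (rule bij_betw_from_nat_into_finite[OF finite])
  have "sum_list (map \<beta> (map (from_nat_into UNIV) [0..<CARD('n)])) =
      (\<Sum>k<CARD('n). \<beta> (from_nat_into UNIV k))"
    by (simp add: interv_sum_list_conv_sum_set_nat comp_def atLeast0LessThan)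
  also have "\<dots> = sum \<beta> UNIV" by (rule sum.reindex_bij_betw[OF bij])
  finally show ?thesis
    using list[of "map (from_nat_into UNIV) [0..<CARD('n)]"] assms(3,4)
    unfolding multi_deriv_def by auto
qed

section \<open>Interpolation by one hidden layer\<close>

text \<open>
  With as many interpolation conditions as there are nonzero derivatives of \<open>\<sigma>\<close> at \<open>s\<close>, the data can
  be matched exactly: this is the dual of the independence on dilates.
\<close>
lemma Hermite_interpolation_shallow:
  assumes "finite Z" "Ck_real l \<sigma>" "\<And>j. j \<le> l \<Longrightarrow> (deriv ^^ j) \<sigma> s \<noteq> 0"
    and size: "sum \<mu> Z = Suc l"
  shows "\<exists>p\<in>shallow \<sigma>. \<forall>z\<in>Z. \<forall>k<\<mu> z. (deriv ^^ k) p z = y z k"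
proof -
  define I where "I = (SIGMA z:Z. {..<\<mu> z})"
  have \<mu>: "k \<le> l" if "(z, k) \<in> I" for z k
    using member_le_sum[of z Z \<mu>] that assms(1) size by (simp add: I_def)
  define V where "V = {f. \<exists>p\<in>shallow \<sigma>. \<forall>(z, k)\<in>I. f (z, k) = (deriv ^^ k) p z}"
  have V: "(\<lambda>(z, k). (deriv ^^ k) p z) \<in> V" if "p \<in> shallow \<sigma>" for p
    using that unfolding V_def by (auto intro!: bexI[of _ p])
  have "\<exists>f\<in>V. \<forall>i\<in>I. f i = (\<lambda>(z, k). y z k) i"
  proof (rule interpolation_of_no_annihilator)
    show "finite I" unfolding I_def using assms(1) by auto
    show "V \<noteq> {}" using V shallow_const by blast
    show "(\<lambda>i. a * f i + b * g i) \<in> V" if fg: "f \<in> V" "g \<in> V" for f g a b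
    proof -
      obtain p q where pq: "p \<in> shallow \<sigma>" "q \<in> shallow \<sigma>"
          "\<forall>(z, k)\<in>I. f (z, k) = (deriv ^^ k) p z" "\<forall>(z, k)\<in>I. g (z, k) = (deriv ^^ k) q z"
        using fg unfolding V_def by blast
      have "a * f (z, k) + b * g (z, k) = (deriv ^^ k) (\<lambda>z. a * p z + b * q z) z" if "(z, k) \<in> I" for z k
        using bspec[OF pq(3) that] bspec[OF pq(4) that]
          higher_deriv_lincomb[OF shallow_Ck[OF assms(2) pq(1)] shallow_Ck[OF assms(2) pq(2)] \<mu>[OF that]]
        by auto
      then show ?thesis
        unfolding V_def using shallow_lincomb[OF pq(1,2)] by blast
    qed
    fix c i assume c: "\<And>f. f \<in> V \<Longrightarrow> (\<Sum>i\<in>I. c i * f i) = 0" and i: "i \<in> I"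
    obtain z k where zk: "i = (z, k)" "z \<in> Z" "k < \<mu> z" using i by (auto simp: I_def)
    have "c (z, k) = 0"
    proof (rule Hermite_functionals_independent_on_dilates[where c = "\<lambda>z k. c (z, k)", OF assms(1-3) size _ zk(2,3)])
      fix w
      show "(\<Sum>z\<in>Z. \<Sum>k<\<mu> z. c (z, k) * (deriv ^^ k) (\<lambda>t. \<sigma> (w * t + s)) z) = 0"
        using c[OF V[OF shallow_unit]] assms(1)
        by (subst sum.Sigma) (auto simp: I_def case_prod_unfold)
    qed
    then show "c i = 0" using zk by simp
  qed
  then obtain f p where f: "\<forall>i\<in>I. f i = (\<lambda>(z, k). y z k) i" and p: "p \<in> shallow \<sigma>"
      "\<forall>(z, k)\<in>I. f (z, k) = (deriv ^^ k) p z"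
    unfolding V_def by blast
  show ?thesis
  proof (intro bexI[OF _ p(1)] ballI allI impI)
    fix z k assume "z \<in> Z" "k < \<mu> z"
    then have "(z, k) \<in> I" by (simp add: I_def)
    then show "(deriv ^^ k) p z = y z k" using f p(2) by force
  qed
qed

text \<open>
  The difference of two ramps from \<open>0\<close> to \<open>1\<close>, one on each side of \<open>z\<close>; each ramp is a difference
  of two units.
\<close>
lemma relu_plateau:
  fixes z :: real
  assumes "\<delta> > 0"
  shows "\<exists>P\<in>shallow relu. (\<forall>t. \<bar>t - z\<bar> \<le> \<delta> \<longrightarrow> P t = 1) \<and> (\<forall>t. \<bar>t - z\<bar> \<ge> 2 * \<delta> \<longrightarrow> P t = 0)"
proof -
  define S where "S a t = (1 / \<delta>) * relu (1 * t + (- a)) + (- 1 / \<delta>) * relu (1 * t + (- a - \<delta>))" for a t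
  define P where "P t = 1 * S (z - 2 * \<delta>) t + (- 1) * S (z + \<delta>) t" for t
  have "S a \<in> shallow relu" for a
    unfolding S_def[abs_def] by (intro shallow_lincomb shallow_unit)
  then have "P \<in> shallow relu"
    unfolding P_def[abs_def] by (intro shallow_lincomb)
  moreover have S: "S a t = (if t \<le> a then 0 else if t \<ge> a + \<delta> then 1 else (t - a) / \<delta>)" for a t
    using assms by (auto simp: S_def relu_def max_def field_simps)
  ultimately show ?thesis
    using assms by (intro bexI[of _ P]) (auto simp: P_def S abs_if split: if_splits)
qed

text \<open>
  Plateaus that vanish near all nodes but one serve as a locally constant Lagrange basis.
\<close>
lemma relu_locally_constant_interpolation:
  fixes Z :: "real set"
  assumes "finite Z"
  shows "\<exists>p\<in>shallow relu. \<forall>z\<in>Z. \<forall>\<^sub>F t in nhds z. p t = y z"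
proof -
  have "\<exists>P\<in>shallow relu. \<forall>z'\<in>Z. \<forall>\<^sub>F t in nhds z'. P t = (if z' = z then 1 else 0)" for z
  proof -
    obtain d where d: "d > 0" "\<And>z'. z' \<in> Z \<Longrightarrow> z' \<noteq> z \<Longrightarrow> d \<le> dist z z'"
      using finite_set_avoid[OF assms, of z] by blast
    \<comment> \<open>the plateau vanishes beyond distance \<open>2 * \<delta>\<close> from \<open>z\<close>, hence within \<open>\<delta>\<close> of any other node\<close>
    define \<delta> where "\<delta> = d / 3"
    have \<delta>: "\<delta> > 0" "3 * \<delta> = d" using d by (auto simp: \<delta>_def)
    obtain P where P: "P \<in> shallow relu" "\<And>t. \<bar>t - z\<bar> \<le> \<delta> \<Longrightarrow> P t = 1"
        "\<And>t. \<bar>t - z\<bar> \<ge> 2 * \<delta> \<Longrightarrow> P t = 0"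
      using relu_plateau[OF \<delta>(1), of z] by blast
    have "\<forall>\<^sub>F t in nhds z'. P t = (if z' = z then 1 else 0)" if "z' \<in> Z" for z'
    proof -
      have "\<forall>\<^sub>F t in nhds z'. t \<in> ball z' \<delta>"
        using \<delta>(1) by (intro eventually_nhds_in_open) auto
      then show ?thesis
      proof eventually_elim
        case (elim t)
        then show ?case
          using d(2)[OF that] \<delta> by (auto simp: dist_real_def intro!: P(2,3))
      qed
    qed
    then show ?thesis using P(1) by blast
  qed
  then obtain P where P: "\<And>z. P z \<in> shallow relu"
      "\<And>z z'. z' \<in> Z \<Longrightarrow> \<forall>\<^sub>F t in nhds z'. P z t = (if z' = z then 1 else 0)"
    by metis
  have "\<forall>\<^sub>F t in nhds z'. (\<Sum>z\<in>Z. y z * P z t) = y z'" if z': "z' \<in> Z" for z'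
  proof -
    have "\<forall>\<^sub>F t in nhds z'. \<forall>z\<in>Z. P z t = (if z' = z then 1 else 0)"
      using assms P(2)[OF z'] by (intro eventually_ball_finite) auto
    then show ?thesis
    proof eventually_elim
      case (elim t)
      then have "(\<Sum>z\<in>Z. y z * P z t) = (\<Sum>z\<in>Z. if z' = z then y z else 0)"
        by (intro sum.cong) auto
      then show ?case using assms z' by simp
    qed
  qed
  then show ?thesis
    using shallow_sum[OF assms, of P relu y] P(1) by (intro bexI[of _ "\<lambda>t. \<Sum>z\<in>Z. y z * P z t"]) auto
qed

section \<open>Interpolating networks and minimisers\<close>

text \<open>
  The directions that fail to separate two given points form a hyperplane, and finitely many
  hyperplanes do not cover the space.
\<close>
lemma exists_injective_direction:
  fixes X :: "(real ^ 'n) set"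
  assumes "finite X"
  shows "\<exists>v. inj_on (\<lambda>x. v \<bullet> x) X"
proof -
  define N where "N = (\<Union>(x, y)\<in>{(x, y)\<in>X \<times> X. x \<noteq> y}. {v. (x - y) \<bullet> v = 0})"
  have "finite {(x, y)\<in>X \<times> X. x \<noteq> y}" using assms by (auto intro: rev_finite_subset[of "X \<times> X"])
  then have "negligible N"
    unfolding N_def by (intro negligible_Union finite_imageI) (auto intro!: negligible_hyperplane)
  then obtain v where "v \<notin> N" using non_negligible_UNIV by (metis UNIV_eq_I)
  then have "inj_on (\<lambda>x. v \<bullet> x) X"
    by (auto simp: N_def inj_on_def inner_diff_left inner_commute[of v])
  then show ?thesis ..
qed

lemma J_reg_eq_0:
  assumes "\<And>x. x \<in> \<Omega>h \<Longrightarrow> u x = gh x"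
    and "\<And>x \<beta>. x \<in> \<Omega>h \<Longrightarrow> \<beta> \<in> multi_indices m \<Longrightarrow> multi_deriv \<beta> u x = 0"
    and "R (\<lambda>\<beta> \<in> multi_indices m. 0) = 0"
  shows "J_reg m \<Omega>h \<alpha> gh \<omega>D \<omega>R R u = 0"
proof -
  have "(\<lambda>\<beta> \<in> multi_indices m. multi_deriv \<beta> u x) = (\<lambda>\<beta> \<in> multi_indices m. 0)" if "x \<in> \<Omega>h" for x
    using assms(2)[OF that] by (intro restrict_ext)
  then have "(\<Sum>x\<in>\<Omega>h. ennreal (\<omega>R x) * R (\<lambda>\<beta> \<in> multi_indices m. multi_deriv \<beta> u x)) = 0"
    using assms(3) by (intro sum.neutral) auto
  moreover have "(\<Sum>\<tau>=1..2. \<alpha> \<tau> * (\<Sum>x\<in>\<Omega>h. \<omega>D x * \<bar>u x - gh x\<bar> ^ \<tau>)) = 0"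
  proof (intro sum.neutral ballI)
    fix \<tau> :: nat assume "\<tau> \<in> {1..2}"
    then have "(\<Sum>x\<in>\<Omega>h. \<omega>D x * \<bar>u x - gh x\<bar> ^ \<tau>) = 0"
      using assms(1) by (intro sum.neutral) auto
    then show "\<alpha> \<tau> * (\<Sum>x\<in>\<Omega>h. \<omega>D x * \<bar>u x - gh x\<bar> ^ \<tau>) = 0" by simp
  qed
  ultimately show ?thesis by (simp add: J_reg_def)
qed

text \<open>
  Zero is the least possible loss. The value \<open>c\<close> at the extra point \<open>x0\<close> parametrises
  infinitely many functions attaining it.
\<close>
lemma infinitely_many_minimisers:
  fixes \<Omega>h :: "(real ^ 'n) set"
  assumes "R (\<lambda>\<beta> \<in> multi_indices m. 0) = 0"
    and "\<And>c. \<exists>u\<in>H. (\<forall>x\<in>\<Omega>h. u x = gh x \<and> (\<forall>\<beta>\<in>multi_indices m. multi_deriv \<beta> u x = 0)) \<and> u x0 = c"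
  shows "(\<exists>u\<in>H. is_arg_min (J_reg m \<Omega>h \<alpha> gh \<omega>D \<omega>R R) (\<lambda>v. v \<in> H) u \<and>
                J_reg m \<Omega>h \<alpha> gh \<omega>D \<omega>R R u = 0) \<and>
         infinite {u \<in> H. is_arg_min (J_reg m \<Omega>h \<alpha> gh \<omega>D \<omega>R R) (\<lambda>v. v \<in> H) u \<and>
                         J_reg m \<Omega>h \<alpha> gh \<omega>D \<omega>R R u = 0}" (is "?ex \<and> infinite ?S")
proof -
  have "c \<in> (\<lambda>u. u x0) ` ?S" for c
  proof -
    obtain u where u: "u \<in> H" "\<And>x. x \<in> \<Omega>h \<Longrightarrow> u x = gh x"
        "\<And>x \<beta>. x \<in> \<Omega>h \<Longrightarrow> \<beta> \<in> multi_indices m \<Longrightarrow> multi_deriv \<beta> u x = 0" "u x0 = c"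
      using assms(2) by metis
    have "J_reg m \<Omega>h \<alpha> gh \<omega>D \<omega>R R u = 0"
      by (rule J_reg_eq_0) (use u(2,3) assms(1) in auto)
    then show ?thesis
      using u(1,4) by (intro image_eqI[of _ _ u]) (auto simp: is_arg_min_def)
  qed
  then have surj: "(\<lambda>u. u x0) ` ?S = UNIV" by blast
  have inf: "infinite ?S"
  proof
    assume "finite ?S"
    then have "finite ((\<lambda>u. u x0) ` ?S)" by (rule finite_imageI)
    then show False unfolding surj by (simp add: infinite_UNIV_char_0)
  qed
  obtain u where u: "u \<in> ?S"
    using infinite_imp_nonempty[OF inf] unfolding ex_in_conv[symmetric] by (elim exE)
  have ?ex by (rule bexI[of _ u]) (use u in simp_all)
  then show ?thesis using inf by (rule conjI)
qed

text \<open>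
  Smoothness and flatness of a ridge network at \<open>x\<close> are read off from a function \<open>F\<close> of one
  variable that describes it near \<open>x\<close>. For a smooth activation \<open>F\<close> is the same at all points;
  for ReLU it is a constant that depends on \<open>x\<close>.
\<close>
lemma ridge_in_smooth_network_class:
  fixes v :: "real ^ 'n"
  assumes "open \<Omega>" "\<Omega>h \<subseteq> \<Omega>" "L \<ge> 2" "p \<in> shallow \<sigma>"
    and local: "\<And>x. x \<in> \<Omega>h \<Longrightarrow> \<exists>U F. open U \<and> x \<in> U \<and> U \<subseteq> \<Omega> \<and> Ck_real r F \<and>
      (\<forall>y\<in>U. p ((\<sigma> ^^ (L - 2)) (v \<bullet> y + \<beta>)) = F (v \<bullet> y)) \<and>
      (\<forall>k. 1 \<le> k \<and> k \<le> m \<longrightarrow> (deriv ^^ k) F (v \<bullet> x) = 0)"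
    and "m \<le> r"
  defines "u \<equiv> restrict (\<lambda>x. p ((\<sigma> ^^ (L - 2)) (v \<bullet> x + \<beta>))) \<Omega>"
  shows "u \<in> smooth_network_class \<sigma> L \<Omega> r \<Omega>h"
    and "\<And>x \<gamma>. x \<in> \<Omega>h \<Longrightarrow> \<gamma> \<in> multi_indices m \<Longrightarrow> multi_deriv \<gamma> u x = 0"
proof -
  have "Ck_at r u x \<and> (\<forall>\<gamma>\<in>multi_indices m. multi_deriv \<gamma> u x = 0)" if x: "x \<in> \<Omega>h" for x
  proof -
    obtain U F where U: "open U" "x \<in> U" "U \<subseteq> \<Omega>" and F: "Ck_real r F"
        and eq: "\<And>y. y \<in> U \<Longrightarrow> p ((\<sigma> ^^ (L - 2)) (v \<bullet> y + \<beta>)) = F (v \<bullet> y)"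
        and flat: "\<And>k. 1 \<le> k \<Longrightarrow> k \<le> m \<Longrightarrow> (deriv ^^ k) F (v \<bullet> x) = 0"
      using local[OF x] by metis
    have u: "u y = F (v \<bullet> y)" if "y \<in> U" for y
      using eq[OF that] U(3) that by (auto simp: u_def)
    have "Ck_on r u U"
      by (rule Ck_on_ridge[where c = 1 and F = F and v = v]) (use U(1) u F in auto)
    then have "Ck_at r u x" unfolding Ck_at_def using U by blast
    moreover have "multi_deriv \<gamma> u x = 0" if "\<gamma> \<in> multi_indices m" for \<gamma>
    proof -
      have s: "1 \<le> sum \<gamma> UNIV" "sum \<gamma> UNIV \<le> m" using that by (auto simp: multi_indices_def)
      show ?thesis
        using multi_deriv_ridge[OF U(1) u Ck_real_mono[OF F] U(2), of \<gamma>] s flat[OF s] assms(6) by auto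
    qed
    ultimately show ?thesis by blast
  qed
  then show "u \<in> smooth_network_class \<sigma> L \<Omega> r \<Omega>h"
      and "\<And>x \<gamma>. x \<in> \<Omega>h \<Longrightarrow> \<gamma> \<in> multi_indices m \<Longrightarrow> multi_deriv \<gamma> u x = 0"
    using ridge_network[OF assms(3,4)]
    unfolding smooth_network_class_def network_class_def u_def by blast+
qed

lemma strictly_monotone_imp_inj:
  fixes f :: "'a :: linorder \<Rightarrow> 'b :: order"
  assumes "strict_mono f \<or> strict_antimono_on UNIV f"
  shows "inj f"
proof (rule injI, rule ccontr)
  fix x y assume "f x = f y" "x \<noteq> y"
  then show False
    using assms by (metis UNIV_I less_irrefl monotone_onD neqE strict_monoD)
qed

text \<open>
  The offset \<open>\<beta>\<close> makes \<open>v \<bullet> x + \<beta>\<close> positive at all interpolation points. There the intermediate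
  layers act as the identity, so the points stay separated, and a locally constant interpolant
  in the last hidden layer gives a network that is locally constant at each of the points.
\<close>
lemma relu_interpolant:
  fixes \<Omega> \<Omega>h :: "(real ^ 'n) set"
  assumes "open \<Omega>" "\<Omega>h \<subseteq> \<Omega>" "finite \<Omega>h" "x0 \<in> \<Omega> - \<Omega>h" "L \<ge> 2"
  shows "\<exists>u\<in>smooth_network_class relu L \<Omega> m \<Omega>h.
    (\<forall>x\<in>\<Omega>h. u x = gh x \<and> (\<forall>\<beta>\<in>multi_indices m. multi_deriv \<beta> u x = 0)) \<and> u x0 = c"
proof -
  let ?X = "insert x0 \<Omega>h"
  have X: "finite ?X" using assms(3) by simp
  obtain v where v: "inj_on (\<lambda>x. v \<bullet> x) ?X" using exists_injective_direction[OF X] by blast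
  define \<beta> where "\<beta> = 1 + (\<Sum>x\<in>?X. \<bar>v \<bullet> x\<bar>)"
  define \<psi> where "\<psi> x = (relu ^^ (L - 2)) (v \<bullet> x + \<beta>)" for x
  have pos: "v \<bullet> x + \<beta> > 0" if "x \<in> ?X" for x
    using member_le_sum[OF that, of "\<lambda>x. \<bar>v \<bullet> x\<bar>"] X by (auto simp: \<beta>_def)
  have relu_pos: "(relu ^^ n) t = t" if "t > 0" for n t
    using that by (induction n) (auto simp: relu_def)
  have \<psi>: "\<psi> x = v \<bullet> x + \<beta>" if "x \<in> ?X" for x
    using relu_pos[OF pos[OF that]] by (simp add: \<psi>_def)
  have inj: "inj_on \<psi> ?X"
    using v \<psi> by (auto simp: inj_on_def)
  define y where "y = (\<lambda>x. if x = x0 then c else gh x) \<circ> the_inv_into ?X \<psi>"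
  have y: "y (\<psi> x) = (if x = x0 then c else gh x)" if "x \<in> ?X" for x
    using the_inv_into_f_f[OF inj that] by (simp add: y_def)
  obtain p where p: "p \<in> shallow relu" "\<And>x. x \<in> ?X \<Longrightarrow> \<forall>\<^sub>F t in nhds (\<psi> x). p t = y (\<psi> x)"
    using relu_locally_constant_interpolation[of "\<psi> ` ?X" y] X by blast
  have val: "p (\<psi> x) = (if x = x0 then c else gh x)" if "x \<in> ?X" for x
    using eventually_nhds_x_imp_x[OF p(2)[OF that]] y[OF that] by simp
  have cont_relu: "continuous_on UNIV (relu ^^ n)" for n
  proof (induction n)
    case (Suc n)
    have "continuous_on UNIV relu"
      unfolding relu_def[abs_def] by (intro continuous_intros)
    then show ?case using continuous_on_compose2[OF _ Suc, of UNIV relu] by (simp add: comp_def)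
  qed (simp add: id_def)
  have cont: "isCont \<psi> x" for x
  proof -
    have "isCont (relu ^^ (L - 2)) (v \<bullet> x + \<beta>)"
      using cont_relu continuous_on_eq_continuous_at by blast
    then show ?thesis
      unfolding \<psi>_def[abs_def] by (rule isCont_o2[rotated]) (intro continuous_intros)
  qed
  define u where "u = restrict (\<lambda>x. p ((relu ^^ (L - 2)) (v \<bullet> x + \<beta>))) \<Omega>"
  have u: "u x = p (\<psi> x)" if "x \<in> \<Omega>" for x using that by (simp add: u_def \<psi>_def)
  have local: "\<exists>U F. open U \<and> x \<in> U \<and> U \<subseteq> \<Omega> \<and> Ck_real m F \<and>
      (\<forall>y\<in>U. p ((relu ^^ (L - 2)) (v \<bullet> y + \<beta>)) = F (v \<bullet> y)) \<and>
      (\<forall>k. 1 \<le> k \<and> k \<le> m \<longrightarrow> (deriv ^^ k) F (v \<bullet> x) = 0)" if x: "x \<in> \<Omega>h" for x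
  proof -
    have "\<forall>\<^sub>F z in nhds x. p (\<psi> z) = y (\<psi> x)"
      using eventually_compose_filterlim[OF p(2)] cont[of x] x
      by (auto simp: isCont_def tendsto_at_iff_tendsto_nhds)
    moreover have "\<forall>\<^sub>F z in nhds x. z \<in> \<Omega>"
      using assms(1,2) x by (intro eventually_nhds_in_open) auto
    ultimately have "\<forall>\<^sub>F z in nhds x. p (\<psi> z) = y (\<psi> x) \<and> z \<in> \<Omega>"
      by (rule eventually_conj)
    then obtain U where U: "open U" "x \<in> U" "\<And>z. z \<in> U \<Longrightarrow> p (\<psi> z) = y (\<psi> x) \<and> z \<in> \<Omega>"
      unfolding eventually_nhds by blast
    have "(deriv ^^ k) (\<lambda>t::real. y (\<psi> x)) t = 0" if k1: "1 \<le> k" for k t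
    proof -
      obtain j where k: "k = Suc j" using k1 by (cases k) auto
      have zero: "(deriv ^^ j) (\<lambda>t::real. 0::real) = (\<lambda>t. 0)" for j
        by (induction j) auto
      have "deriv (\<lambda>t::real. y (\<psi> x)) = (\<lambda>t. 0)" by auto
      then show ?thesis by (simp add: k funpow_Suc_right zero del: funpow.simps)
    qed
    then show ?thesis
      using U by (intro exI[of _ U] exI[of _ "\<lambda>_. y (\<psi> x)"]) (auto simp: Ck_real_const \<psi>_def)
  qed
  note R = ridge_in_smooth_network_class[OF assms(1,2,5) p(1) local order_refl, folded u_def]
  show ?thesis
  proof (intro bexI[OF _ R(1)] conjI ballI)
    show "u x = gh x" if "x \<in> \<Omega>h" for x
      using u[of x] val[of x] that assms(2,4) by auto
    show "u x0 = c" using u[of x0] val[of x0] assms(4) by auto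
  qed (use R(2) in auto)
qed

text \<open>
  Each point of \<open>\<Omega>h\<close> imposes \<open>m + 1\<close> conditions, and \<open>x0\<close> imposes one. The total is \<open>l + 1\<close>,
  which equals the number of derivatives of \<open>\<sigma>\<close>, of orders \<open>0\<close> to \<open>l\<close>, that are nonzero at \<open>s\<close>.
  Injectivity of \<open>\<sigma>\<close> keeps the points separated until they reach the last hidden layer.
\<close>
lemma smooth_interpolant:
  fixes \<Omega> \<Omega>h :: "(real ^ 'n) set"
  assumes "open \<Omega>" "\<Omega>h \<subseteq> \<Omega>" "finite \<Omega>h" "\<Omega>h \<noteq> {}" "x0 \<in> \<Omega> - \<Omega>h" "L \<ge> 2"
    and l: "l = card \<Omega>h * (m + 1)" and "Ck_real l \<sigma>" "\<And>k. k \<le> l \<Longrightarrow> (deriv ^^ k) \<sigma> s \<noteq> 0"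
    and "L > 2 \<Longrightarrow> inj \<sigma>"
  shows "\<exists>u\<in>smooth_network_class \<sigma> L \<Omega> l \<Omega>h.
    (\<forall>x\<in>\<Omega>h. u x = gh x \<and> (\<forall>\<beta>\<in>multi_indices m. multi_deriv \<beta> u x = 0)) \<and> u x0 = c"
proof -
  let ?X = "insert x0 \<Omega>h"
  have X: "finite ?X" using assms(3) by simp
  have "card \<Omega>h \<ge> 1" using assms(3,4) by (simp add: Suc_le_eq card_gt_0_iff)
  then have "1 * (m + 1) \<le> l" unfolding l by (rule mult_le_mono1)
  then have ml: "m \<le> l" by simp
  obtain v where v: "inj_on (\<lambda>x. v \<bullet> x) ?X" using exists_injective_direction[OF X] by blast
  define \<psi> where "\<psi> = \<sigma> ^^ (L - 2)"
  have "inj \<psi>"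
    using inj_fn[OF assms(10)] assms(6) by (cases "L = 2") (auto simp: \<psi>_def)
  then have inj: "inj_on (\<lambda>x. \<psi> (v \<bullet> x)) ?X"
    using v by (auto simp: inj_on_def)
  \<comment> \<open>the nodes of \<open>p\<close> are the images \<open>\<psi> (v \<bullet> x)\<close>; multiplicities and data are transported along \<open>\<pi>\<close>\<close>
  define \<pi> where "\<pi> = the_inv_into ?X (\<lambda>x. \<psi> (v \<bullet> x))"
  have \<pi>: "\<pi> (\<psi> (v \<bullet> x)) = x" if "x \<in> ?X" for x
    unfolding \<pi>_def by (rule the_inv_into_f_f[OF inj that])
  define \<mu> where "\<mu> z = (if \<pi> z = x0 then 1 else m + 1)" for z
  define y where "y z k = (if k = 0 then if \<pi> z = x0 then c else gh (\<pi> z) else 0)" for z and k :: nat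
  have "sum \<mu> ((\<lambda>x. \<psi> (v \<bullet> x)) ` ?X) = (\<Sum>x\<in>?X. if x = x0 then 1 else m + 1)"
    unfolding sum.reindex[OF inj] by (intro sum.cong) (auto simp: \<mu>_def \<pi>)
  also have "\<dots> = 1 + (\<Sum>x\<in>\<Omega>h. m + 1)"
  proof -
    have "(\<Sum>x\<in>\<Omega>h. if x = x0 then 1 else m + 1) = (\<Sum>x\<in>\<Omega>h. m + 1)"
      using assms(5) by (intro sum.cong) auto
    then show ?thesis using assms(3,5) by simp
  qed
  also have "\<dots> = Suc l" by (simp add: l)
  finally have size: "sum \<mu> ((\<lambda>x. \<psi> (v \<bullet> x)) ` ?X) = Suc l" .
  obtain p where p: "p \<in> shallow \<sigma>"
      and ip: "\<And>x k. x \<in> ?X \<Longrightarrow> k < \<mu> (\<psi> (v \<bullet> x)) \<Longrightarrow>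
        (deriv ^^ k) p (\<psi> (v \<bullet> x)) = y (\<psi> (v \<bullet> x)) k"
    using Hermite_interpolation_shallow[OF finite_imageI[OF X] assms(8,9) size, of y] by blast
  define F where "F t = p (\<psi> t)" for t
  have C: "Ck_real l p" "Ck_real l \<psi>"
    using shallow_Ck[OF assms(8) p] Ck_real_funpow[OF assms(8)] by (auto simp: \<psi>_def)
  have CF: "Ck_real l F"
    unfolding F_def[abs_def] by (rule Ck_real_compose[OF C])
  have flat: "(deriv ^^ k) F (v \<bullet> x) = 0" if "x \<in> \<Omega>h" "1 \<le> k" "k \<le> m" for x k
    unfolding F_def[abs_def]
  proof (rule higher_deriv_comp_zero[where p = p and \<psi> = \<psi>])
    show "(deriv ^^ j) p (\<psi> (v \<bullet> x)) = 0" if "1 \<le> j" "j \<le> k" for j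
    proof -
      have "x \<noteq> x0" using \<open>x \<in> \<Omega>h\<close> assms(5) by auto
      then show ?thesis
        using ip[of x j] \<open>x \<in> \<Omega>h\<close> \<open>k \<le> m\<close> that by (auto simp: \<mu>_def \<pi> y_def)
    qed
  qed (use that ml Ck_real_mono C in auto)
  define u where "u = restrict (\<lambda>x. p ((\<sigma> ^^ (L - 2)) (v \<bullet> x + 0))) \<Omega>"
  have u: "u x = p (\<psi> (v \<bullet> x))" if "x \<in> \<Omega>" for x using that by (simp add: u_def \<psi>_def)
  have val: "u x = (if x = x0 then c else gh x)" if "x \<in> ?X" for x
    using ip[OF that, of 0] u[of x] that assms(2,5) by (auto simp: \<mu>_def \<pi> y_def)
  have local: "\<exists>U F. open U \<and> x \<in> U \<and> U \<subseteq> \<Omega> \<and> Ck_real l F \<and>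
      (\<forall>y\<in>U. p ((\<sigma> ^^ (L - 2)) (v \<bullet> y + 0)) = F (v \<bullet> y)) \<and>
      (\<forall>k. 1 \<le> k \<and> k \<le> m \<longrightarrow> (deriv ^^ k) F (v \<bullet> x) = 0)" if x: "x \<in> \<Omega>h" for x
    using assms(1,2) x CF flat[OF x]
    by (intro exI[of _ \<Omega>] exI[of _ F]) (auto simp: F_def \<psi>_def)
  note R = ridge_in_smooth_network_class[OF assms(1,2,6) p local ml, folded u_def]
  show ?thesis
    using val R(2) assms(5) by (intro bexI[OF _ R(1)]) auto
qed

theorem theorem4p1:
  fixes \<Omega> \<Omega>h :: "(real ^ 'n) set"
    and H :: "(real ^ 'n \<Rightarrow> real) set"
    and \<sigma> :: "real \<Rightarrow> real"
    and m L :: nat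
    and \<alpha> :: "nat \<Rightarrow> real"
    and gh \<omega>D \<omega>R :: "real ^ 'n \<Rightarrow> real"
    and R :: "(('n \<Rightarrow> nat) \<Rightarrow> real) \<Rightarrow> ennreal"
  assumes "bounded_lipschitz_domain \<Omega>"
    and "m \<ge> 1"
    and "\<Omega>h \<subseteq> \<Omega>" and "finite \<Omega>h" and "\<Omega>h \<noteq> {}"
    and "\<alpha> 1 \<ge> 0" and "\<alpha> 2 \<ge> 0"
    and "\<And>x. x \<in> \<Omega>h \<Longrightarrow> \<omega>D x \<ge> 0" and "\<And>x. x \<in> \<Omega>h \<Longrightarrow> \<omega>R x \<ge> 0"
    and "R \<in> borel_measurable (deriv_space m)"
    and "R (\<lambda>\<beta> \<in> multi_indices m. 0) = 0"
    and "(\<sigma> = relu \<and> int L \<ge> \<lceil>log 2 (real CARD('n) + 1)\<rceil> + 1 \<and>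
            H = smooth_network_class \<sigma> L \<Omega> m \<Omega>h)
       \<or> (\<exists>l. l = card \<Omega>h * (m + 1) \<and>
            Ck_real l \<sigma> \<and> (\<exists>s. \<forall>k\<le>l. (deriv ^^ k) \<sigma> s \<noteq> 0) \<and>
            L \<ge> 2 \<and> (L > 2 \<longrightarrow> strict_mono \<sigma> \<or> strict_antimono_on UNIV \<sigma>) \<and>
            H = smooth_network_class \<sigma> L \<Omega> l \<Omega>h)"
  shows "(\<exists>u\<in>H. is_arg_min (J_reg m \<Omega>h \<alpha> gh \<omega>D \<omega>R R) (\<lambda>v. v \<in> H) u \<and>
                J_reg m \<Omega>h \<alpha> gh \<omega>D \<omega>R R u = 0) \<and>
         infinite {u \<in> H. is_arg_min (J_reg m \<Omega>h \<alpha> gh \<omega>D \<omega>R R) (\<lambda>v. v \<in> H) u \<and>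
                         J_reg m \<Omega>h \<alpha> gh \<omega>D \<omega>R R u = 0}"
proof -
  have "open \<Omega>" "\<Omega> \<noteq> {}" using assms(1) by (auto simp: bounded_lipschitz_domain_def)
  then have "infinite \<Omega>" using finite_imp_not_open by blast
  then obtain x0 where x0: "x0 \<in> \<Omega> - \<Omega>h"
    using assms(4) by (metis Diff_eq_empty_iff ex_in_conv finite_subset)
  have "\<exists>u\<in>H. (\<forall>x\<in>\<Omega>h. u x = gh x \<and> (\<forall>\<beta>\<in>multi_indices m. multi_deriv \<beta> u x = 0)) \<and> u x0 = c" for c
    using assms(12)
  proof (elim disjE conjE exE)
    assume \<sigma>: "\<sigma> = relu" and L: "\<lceil>log 2 (real CARD('n) + 1)\<rceil> + 1 \<le> int L"
      and H: "H = smooth_network_class \<sigma> L \<Omega> m \<Omega>h"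
    have "1 \<le> \<lceil>log 2 (real CARD('n) + 1)\<rceil>" by (simp add: one_le_ceiling)
    then have "L \<ge> 2" using L by linarith
    then show ?thesis
      unfolding H \<sigma> by (rule relu_interpolant[OF \<open>open \<Omega>\<close> assms(3,4) x0])
  next
    fix l s
    assume l: "l = card \<Omega>h * (m + 1)" and \<sigma>: "Ck_real l \<sigma>" "\<forall>k\<le>l. (deriv ^^ k) \<sigma> s \<noteq> 0"
      and L: "2 \<le> L" "2 < L \<longrightarrow> strict_mono \<sigma> \<or> strict_antimono_on UNIV \<sigma>"
      and H: "H = smooth_network_class \<sigma> L \<Omega> l \<Omega>h"
    have inj: "inj \<sigma>" if "2 < L"
      using L(2) that by (intro strictly_monotone_imp_inj) simp
    show ?thesis
      unfolding H by (rule smooth_interpolant[where s = s, OF \<open>open \<Omega>\<close> assms(3-5) x0 L(1) l \<sigma>(1)])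
        (use \<sigma>(2) inj in simp_all)
  qed
  then show ?thesis
    by (rule infinitely_many_minimisers[where R = R and m = m and ?x0.0 = x0, OF assms(11)])
qed

end
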